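(* Let $(X,\mathcal{A},\mu,T,\xi)$ be a mixing probability preserving Gibbs-Markov system, and $(A_l)_{l\ge 1}$ a sequence in $\mathcal{A}$ with $0<\mu(A_l)\to 0$ such that each $A_l$ is $\xi$-measurable. Fix $r>0$ and define $$\mathcal{V}:=\Big\{\big(\textstyle\int_C u\,d\mu\big)^{-1}1_C\,u\odot\mu:\ u\in\mathcal{U}(r),\ C\subseteq X\ \xi\text{-measurable},\ \int_C u\,d\mu>0\Big\},$$ $$\mathcal{V}_l:=\Big\{\big(\textstyle\int_C u\,d\mu\big)^{-1}1_C\,u\odot\mu:\ u\in\mathcal{U}(r),\ C\subseteq A_l\ \xi\text{-measurable},\ \int_C u\,d\mu>0\Big\}.$$ A) For every $d\ge 1$ and $\delta\in(0,1]$, as $l\to\infty$, $$\nu\Big(\bigcap_{j=1}^d T_{A_l}^{-(j-1)}\{\varphi_{A_l}=k_l^{(j)}\}\Big)\sim\mu(A_l)^d\,e^{-\mu(A_l)\sum_{j=1}^d k_l^{(j)}}$$ uniformly in $\nu\in\mathcal{V}$ and $(k_l^{(1)}),\ldots,(k_l^{(d)})\in\mathcal{K}_\delta(A_l)$, and $$\nu_l\Big(\bigcap_{j=1}^d T_{A_l}^{-(j-1)}\{\varphi_{A_l}=k_l^{(j)}\}\Big)\sim\mu(A_l)^d\,e^{-\mu(A_l)\sum_{j=1}^d k_l^{(j)}}$$ uniformly in $(\nu_l)\in\prod_{l\ge 1}\mathcal{V}_l$ and $(k_l^{(1)}),\ldots,(k_l^{(d)})\in\mathcal{K}_\delta(A_l)$.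 B) Suppose, in addition, that $\mathrm{diam}(A_l)\to 0$ as $l\to\infty$, that $A_l\subseteq A_l'$ for suitable $A_l'\in\beta$, and that, for some $d\geq 1$, $(C_l^{(1)})_{l\ge1},\ldots,(C_l^{(d)})_{l\ge1}$ are sequences of $\xi$-measurable sets of positive measure with $C_l^{(j)}\subseteq A_l$. Set $c_l^{(j)}:=\mu(C_l^{(j)})/\mu(A_l)$. Then, for every $\delta\in(0,1]$, as $l\to\infty$, $$\nu\Big(\bigcap_{j=1}^d T_{A_l}^{-(j-1)}\big(\{\varphi_{A_l}=k_l^{(j)}\}\cap T_{A_l}^{-1}C_l^{(j)}\big)\Big)\sim\mu(A_l)^d\Big(\prod_{j=1}^d c_l^{(j)}\Big)e^{-\mu(A_l)\sum_{j=1}^d k_l^{(j)}}$$ uniformly in $\nu\in\mathcal{V}$ and $(k_l^{(1)}),\ldots,(k_l^{(d)})\in\mathcal{K}_\delta(A_l)$, and $$\nu_l\Big(\bigcap_{j=1}^d T_{A_l}^{-(j-1)}\big(\{\varphi_{A_l}=k_l^{(j)}\}\cap T_{A_l}^{-1}C_l^{(j)}\big)\Big)\sim\mu(A_l)^d\Big(\prod_{j=1}^d c_l^{(j)}\Big)e^{-\mu(A_l)\sum_{j=1}^d k_l^{(j)}}$$ uniformly in $(\nu_l)\in\prod_{l\ge 1}\mathcal{V}_l$ and $(k_l^{(1)}),\ldots,(k_l^{(d)})\in\mathcal{K}_\delta(A_l)$.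
   Context: Piecewise invertible systems. $(X,\mathrm{d}_X)$ is a metric space with $\mathrm{diam}(X)<\infty$ and Borel $\sigma$-algebra $\mathcal{A}$. A piecewise invertible probability preserving system is $(X,\mathcal{A},\mu,T,\xi)$ where $T:X\to X$ preserves the probability measure $\mu$, and $\xi$ is a finite or countable partition mod $\mu$ of $X$ into pairwise disjoint open sets such that the restriction of $T$ to each $Z\in\xi$ is a homeomorphism onto $TZ$. Let $\xi_n$ be the family of cylinders of rank $n$, i.e. sets $\bigcap_{i=0}^{n-1}T^{-i}Z_i$ with $Z_i\in\xi$. For $Z\in\xi$, $v_Z:=(T|_Z)^{-1}:TZ\to Z$ is the inverse branch and $v_Z':=d(\mu\circ v_Z)/d\mu$. The system is uniformly expanding if there is $\rho\in(0,1)$ with $\mathrm{d}_X(x,y)\le\rho\,\mathrm{d}_X(Tx,Ty)$ whenever $x,y\in Z\in\xi$; its $n$-th iterate is $(X,\mathcal{A},\mu,T^n,\xi_n)$. It is Markov if $\mu(TZ\cap Z')>0$ for $Z,Z'\in\xi$ implies $Z'\subseteq TZ$. A set is $\xi$-measurable if it is a union of elements of $\xi$ (mod $\mu$). Gibbs-Markov. A Markov system is Gibbs-Markov if some iterate $T^N$ is uniformly expanding, $\inf_{Z\in\xi}\mu(TZ)>0$, and there are $r_0>0$ and versions of the $v_Z'$, $Z\in\xi$, such that $|v_Z'(x)/v_Z'(y)-1|\le r_0\,\mathrm{d}_X(x,y)$ for $x,y\in TZ$, $Z\in\xi$. Densities. $\mathcal{D}(\mu)$ is the set of probability densities w.r.t.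 $\mu$, $u\odot\mu(A):=\int_A u\,d\mu$. For $B\subseteq X$ and $w\ge 0$, $\mathrm{R}_B(w):=\inf\{s>0: w(x)\le(1+s\,\mathrm{d}_X(x,y))w(y)\text{ for } x,y\in B\}$ (with $\inf\varnothing=\infty$; for densities, conditions on $\mathrm{R}_B$ are understood for a suitable version). $\beta$ is the partition generated by $\{TZ:Z\in\xi\}$, $\mathrm{R}_\beta(w):=\sup_{B\in\beta}\mathrm{R}_B(w)$, and $\mathcal{U}(s):=\{u\in\mathcal{D}(\mu):\mathrm{R}_\beta(u)\le s\}$. Hitting times. $\varphi_A(x):=\inf\{n\ge 1:T^nx\in A\}\in\{1,2,\ldots,\infty\}$, and $T_Ax:=T^{\varphi_A(x)}x$ (defined a.e. if $\mu(A)>0$) is the first entrance map. For $\delta\in(0,1]$, $\mathcal{K}_\delta(A_l):=\{(k_l)_{l\ge 1}:k_l\in\mathbb{N},\ \delta\le\mu(A_l)k_l\le\delta^{-1}\text{ for } l\ge 1\}$. Uniformity of $a_l\sim b_l$ in some parameters means that for every $\varepsilon>0$ there is $l_0$ such that $|a_l/b_l-1|\le\varepsilon$ for all $l\ge l_0$ and all admissible parameters. *)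

theory Defs
  imports "HOL-Probability.Probability"
begin

definition inverse_branch :: "('a \<Rightarrow> 'a) \<Rightarrow> 'a set \<Rightarrow> 'a \<Rightarrow> 'a" where
  "inverse_branch T Z = the_inv_into Z T"

text \<open>The metric space \<open>X\<close> is the whole type \<open>'a\<close>. The assumption that the images \<open>T ` Z\<close> are
  measurable makes explicit what is presupposed by expressions such as \<open>\<mu>(TZ)\<close>; it is not automatic
  in an arbitrary metric space.\<close>

locale piecewise_invertible = prob_space M
  for M :: "'a :: metric_space measure" +
  fixes T :: "'a \<Rightarrow> 'a" and \<xi> :: "'a set set"
  assumes bounded_space: "bounded (UNIV :: 'a set)"
    and sets_eq_borel: "sets M = sets borel"
    and T_measurable: "T \<in> measurable M M"
    and T_preserves: "distr M M T = M"
    and countable_partition: "countable \<xi>"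
    and disjoint_partition: "disjoint \<xi>"
    and open_partition: "\<And>Z. Z \<in> \<xi> \<Longrightarrow> open Z"
    and covers_AE: "AE x in M. x \<in> \<Union>\<xi>"
    and T_homeomorphism:
      "\<And>Z. Z \<in> \<xi> \<Longrightarrow> homeomorphism Z (T ` Z) T (inverse_branch T Z)"
    and image_measurable: "\<And>Z. Z \<in> \<xi> \<Longrightarrow> T ` Z \<in> sets M"

definition cylinders :: "('a \<Rightarrow> 'a) \<Rightarrow> 'a set set \<Rightarrow> nat \<Rightarrow> 'a set set" where
  "cylinders T \<xi> n = {(\<Inter>i<n. (T ^^ i) -` Z i) | Z. \<forall>i<n. Z i \<in> \<xi>}"

definition uniformly_expanding :: "('a :: metric_space \<Rightarrow> 'a) \<Rightarrow> 'a set set \<Rightarrow> bool" where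
  "uniformly_expanding T \<xi> \<longleftrightarrow>
    (\<exists>\<rho>. 0 < \<rho> \<and> \<rho> < 1 \<and> (\<forall>Z\<in>\<xi>. \<forall>x\<in>Z. \<forall>y\<in>Z. dist x y \<le> \<rho> * dist (T x) (T y)))"

text \<open>\<open>w\<close> is a version on \<open>T ` Z\<close> of the Radon-Nikodym derivative of \<open>\<mu> \<circ> v\<^sub>Z\<close> with respect to \<open>\<mu>\<close>;
  its values outside \<open>T ` Z\<close> play no role.\<close>

definition branch_derivative ::
    "'a measure \<Rightarrow> ('a \<Rightarrow> 'a) \<Rightarrow> 'a set \<Rightarrow> ('a \<Rightarrow> real) \<Rightarrow> bool" where
  "branch_derivative M T Z w \<longleftrightarrow>
    w \<in> borel_measurable (restrict_space M (T ` Z)) \<and> (\<forall>x\<in>T ` Z. 0 \<le> w x) \<and>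
    (\<forall>B\<in>sets M. B \<subseteq> T ` Z \<longrightarrow>
      emeasure M (inverse_branch T Z ` B) = (\<integral>\<^sup>+x\<in>B. ennreal (w x) \<partial>M))"

locale markov_system = piecewise_invertible +
  assumes markov: "\<And>Z Z'. Z \<in> \<xi> \<Longrightarrow> Z' \<in> \<xi> \<Longrightarrow> measure M (T ` Z \<inter> Z') > 0 \<Longrightarrow> Z' \<subseteq> T ` Z"

text \<open>In the distortion bound, the case \<open>x = y\<close> forces the chosen versions to be nonzero (hence
  positive) on \<open>T ` Z\<close>, so that the quotient is always meaningful.\<close>

locale gibbs_markov = markov_system +
  assumes iterate_expanding: "\<exists>N\<ge>1. uniformly_expanding (T ^^ N) (cylinders T \<xi> N)"
    and big_images: "0 < (INF Z\<in>\<xi>. measure M (T ` Z))"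
    and distortion: "\<exists>r\<^sub>0>0. \<exists>v'. \<forall>Z\<in>\<xi>. branch_derivative M T Z (v' Z) \<and>
      (\<forall>x\<in>T ` Z. \<forall>y\<in>T ` Z. \<bar>v' Z x / v' Z y - 1\<bar> \<le> r\<^sub>0 * dist x y)"

definition mixing :: "'a measure \<Rightarrow> ('a \<Rightarrow> 'a) \<Rightarrow> bool" where
  "mixing M T \<longleftrightarrow> (\<forall>A\<in>sets M. \<forall>B\<in>sets M.
    (\<lambda>n. measure M (A \<inter> (T ^^ n) -` B)) \<longlonglongrightarrow> measure M A * measure M B)"

definition partition_measurable :: "'a measure \<Rightarrow> 'a set set \<Rightarrow> 'a set \<Rightarrow> bool" where
  "partition_measurable M \<xi> C \<longleftrightarrow>
    C \<in> sets M \<and> (\<exists>\<eta>\<subseteq>\<xi>. AE x in M. x \<in> C \<longleftrightarrow> x \<in> \<Union>\<eta>)"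

definition image_partition :: "('a \<Rightarrow> 'a) \<Rightarrow> 'a set set \<Rightarrow> 'a set set" where
  "image_partition T \<xi> = UNIV // {(x, y). \<forall>Z\<in>\<xi>. x \<in> T ` Z \<longleftrightarrow> y \<in> T ` Z}"

definition prob_densities :: "'a measure \<Rightarrow> ('a \<Rightarrow> real) set" where
  "prob_densities M =
    {u \<in> borel_measurable M. (\<forall>x. 0 \<le> u x) \<and> (\<integral>\<^sup>+x. ennreal (u x) \<partial>M) = 1}"

definition reg_on :: "'a :: metric_space set \<Rightarrow> ('a \<Rightarrow> real) \<Rightarrow> ereal" where
  "reg_on B w = Inf {ereal s | s. s > 0 \<and> (\<forall>x\<in>B. \<forall>y\<in>B. w x \<le> (1 + s * dist x y) * w y)}"

definition reg :: "('a :: metric_space \<Rightarrow> 'a) \<Rightarrow> 'a set set \<Rightarrow> ('a \<Rightarrow> real) \<Rightarrow> ereal" where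
  "reg T \<xi> w = (SUP B\<in>image_partition T \<xi>. reg_on B w)"

definition regular_densities ::
    "'a :: metric_space measure \<Rightarrow> ('a \<Rightarrow> 'a) \<Rightarrow> 'a set set \<Rightarrow> real \<Rightarrow> ('a \<Rightarrow> real) set" where
  "regular_densities M T \<xi> s =
    {u \<in> prob_densities M. \<exists>w\<in>prob_densities M. (AE x in M. u x = w x) \<and> reg T \<xi> w \<le> ereal s}"

text \<open>The family \<open>\<V>\<close> is obtained for \<open>A = UNIV\<close>, and \<open>\<V>\<^sub>l\<close> for \<open>A = A\<^sub>l\<close>.\<close>

definition conditioned_laws ::
    "'a :: metric_space measure \<Rightarrow> ('a \<Rightarrow> 'a) \<Rightarrow> 'a set set \<Rightarrow> real \<Rightarrow> 'a set \<Rightarrow> 'a measure set" where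
  "conditioned_laws M T \<xi> r A =
    {density M (\<lambda>x. ennreal (inverse (LINT y:C|M. u y) * indicator C x * u x)) | u C.
      u \<in> regular_densities M T \<xi> r \<and> C \<subseteq> A \<and> partition_measurable M \<xi> C \<and>
      (LINT y:C|M. u y) > 0}"

definition hitting_time :: "('a \<Rightarrow> 'a) \<Rightarrow> 'a set \<Rightarrow> 'a \<Rightarrow> enat" where
  "hitting_time T A x = Inf {enat n | n. n \<ge> 1 \<and> (T ^^ n) x \<in> A}"

text \<open>The value at points that never enter \<open>A\<close> is arbitrary.\<close>

definition first_entrance :: "('a \<Rightarrow> 'a) \<Rightarrow> 'a set \<Rightarrow> 'a \<Rightarrow> 'a" where
  "first_entrance T A x = (case hitting_time T A x of enat n \<Rightarrow> (T ^^ n) x | \<infinity> \<Rightarrow> x)"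

definition admissible_times :: "'a measure \<Rightarrow> (nat \<Rightarrow> 'a set) \<Rightarrow> real \<Rightarrow> (nat \<Rightarrow> nat) set" where
  "admissible_times M A \<delta> =
    {k. \<forall>l. \<delta> \<le> measure M (A l) * real (k l) \<and> measure M (A l) * real (k l) \<le> inverse \<delta>}"

definition uniformly_asymp ::
    "'p set \<Rightarrow> ('p \<Rightarrow> nat \<Rightarrow> real) \<Rightarrow> ('p \<Rightarrow> nat \<Rightarrow> real) \<Rightarrow> bool" where
  "uniformly_asymp P a b \<longleftrightarrow>
    (\<forall>\<epsilon>>0. \<exists>l\<^sub>0. \<forall>l\<ge>l\<^sub>0. \<forall>p\<in>P. \<bar>a p l / b p l - 1\<bar> \<le> \<epsilon>)"

end

theory Submission
  imports Defs
begin

text \<open>Call a measure absolutely continuous with respect to \<open>\<mu>\<close> regular if on every cylinder of rank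
  \<open>p \<ge> 1\<close> its density varies by a factor of at most \<open>exp (\<kappa> \<theta>\<^sup>p)\<close>. For a suitable \<open>\<kappa>\<close> regularity
  survives restriction to \<open>\<xi>\<close>-measurable sets and transport by \<open>T\<close>, and after one step of transport the
  density of a regular measure is bounded by a constant times its mass. With these two properties mixing
  improves to \<open>\<nu> (T\<^bsup>-n\<^esup> E) = (1 \<plusminus> \<epsilon>) \<nu> X \<mu> E\<close>, for one \<open>n\<close> serving all regular \<open>\<nu>\<close> of bounded
  density and all measurable \<open>E\<close>.

  Let \<open>h m\<close> be the image under \<open>T\<^bsup>m+1\<^esup>\<close> of the part of \<open>\<nu>\<close> that avoids \<open>A\<close> at the times \<open>1, \<dots>, m\<close>.
  Since the density of \<open>h (m - n)\<close> is bounded, orbits entering \<open>A\<close> during the last \<open>n\<close> steps contribute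
  only a density of order \<open>n \<mu> A\<close>, so \<open>h m\<close> is uniformly close to a multiple of \<open>\<mu>\<close> once \<open>\<mu> A\<close> is
  small. Hence each step removes the fraction \<open>(1 \<plusminus> \<epsilon>) \<mu> A\<close> of the remaining mass, which gives the
  exponential law, and the hitting position is uniformly distributed over \<open>A\<close>. As the law restricted to
  the first visit in \<open>C\<close> is regular again, the case of \<open>d\<close> visits follows by induction. Part A is part B
  with \<open>C = A\<close>.\<close>

section \<open>Comparison of masses and integrals\<close>

lemma (in finite_measure) measure_le_of_countable_cover:
  assumes "countable W" "disjoint W" "W \<subseteq> sets M" and cover: "AE x in M. x \<in> \<Union>W"
    and G: "G \<in> sets M" and H: "H \<in> sets M" and "0 \<le> c"
    and le: "\<And>w. w \<in> W \<Longrightarrow> measure M (w \<inter> G) \<le> c * measure M (w \<inter> H)"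
  shows "measure M G \<le> c * measure M H"
proof -
  \<comment> \<open>Countable additivity over \<open>W\<close>, with the sum written as an integral
    against counting measure so that no enumeration of \<open>W\<close> is needed.\<close>
  have decomp: "emeasure M S = (\<integral>\<^sup>+w. emeasure M (w \<inter> S) \<partial>count_space W)"
    if S: "S \<in> sets M" for S
  proof -
    have "emeasure M S = emeasure M (\<Union>w\<in>W. w \<inter> S)"
      using cover S assms(1,3) by (intro emeasure_eq_AE) (auto elim!: eventually_mono intro!: sets.countable_UN')
    also have "\<dots> = (\<integral>\<^sup>+w. emeasure M (w \<inter> S) \<partial>count_space W)"
      using assms(1-3) S
      by (intro emeasure_UN_countable) (auto simp: disjoint_family_on_def disjoint_def)
    finally show ?thesis .
  qed
  have "emeasure M G \<le> (\<integral>\<^sup>+w. ennreal c * emeasure M (w \<inter> H) \<partial>count_space W)"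
    unfolding decomp[OF G]
    using le \<open>0 \<le> c\<close> by (intro nn_integral_mono) (auto simp: emeasure_eq_measure ennreal_mult[symmetric])
  also have "\<dots> = ennreal c * emeasure M H"
    by (simp add: nn_integral_cmult decomp[OF H])
  finally show ?thesis
    using \<open>0 \<le> c\<close> by (simp add: emeasure_eq_measure ennreal_mult[symmetric])
qed

text \<open>Integrating the pointwise bound over \<open>x\<close> in \<open>E\<close> and
  \<open>y\<close> in \<open>F\<close>, one variable after the other, turns an oscillation bound for
  a density into a ratio of masses. The nested almost-everywhere quantifier is the form that
  iterated integration asks for.\<close>

lemma nn_integral_ratio_bound:
  fixes f :: "'a \<Rightarrow> ennreal"
  assumes f: "f \<in> borel_measurable M"
    and E: "E \<in> sets M" and F: "F \<in> sets M"
    and le: "AE x in M. AE y in M. x \<in> E \<longrightarrow> y \<in> F \<longrightarrow> f x \<le> c * f y"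
  shows "(\<integral>\<^sup>+x\<in>E. f x \<partial>M) * emeasure M F \<le> c * (\<integral>\<^sup>+x\<in>F. f x \<partial>M) * emeasure M E"
proof -
  have "(\<integral>\<^sup>+x\<in>E. f x \<partial>M) * emeasure M F
      = (\<integral>\<^sup>+x. (\<integral>\<^sup>+y. f x * indicator E x * indicator F y \<partial>M) \<partial>M)"
    using f E F by (simp add: nn_integral_cmult nn_integral_multc)
  also have "\<dots> \<le> (\<integral>\<^sup>+x. (\<integral>\<^sup>+y. c * (f y * indicator F y) * indicator E x \<partial>M) \<partial>M)"
  proof (rule nn_integral_mono_AE)
    show "AE x in M. (\<integral>\<^sup>+y. f x * indicator E x * indicator F y \<partial>M)
        \<le> (\<integral>\<^sup>+y. c * (f y * indicator F y) * indicator E x \<partial>M)"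
      using le
    proof eventually_elim
      case (elim x)
      then have "AE y in M. f x * indicator E x * indicator F y
          \<le> c * (f y * indicator F y) * indicator E x"
        by eventually_elim (simp split: split_indicator)
      then show ?case by (rule nn_integral_mono_AE)
    qed
  qed
  also have "\<dots> = c * (\<integral>\<^sup>+x\<in>F. f x \<partial>M) * emeasure M E"
    using f E F by (simp add: nn_integral_cmult nn_integral_multc)
  finally show ?thesis .
qed

section \<open>Recursion and contraction for cylinders\<close>

lemma cylinders_0: "cylinders T \<xi> 0 = {UNIV}"
  by (auto simp: cylinders_def)

text \<open>Splitting off the first coordinate exhibits a cylinder as the part of one branch of
  \<open>T\<close> that lies over a shorter cylinder, which is how it is met when measures are
  transported by one step.\<close>

lemma cylinders_Suc: "cylinders T \<xi> (Suc p) = (\<lambda>(Z, Y). Z \<inter> T -` Y) ` (\<xi> \<times> cylinders T \<xi> p)"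
proof safe
  fix W assume "W \<in> cylinders T \<xi> (Suc p)"
  then obtain Z where Z: "W = (\<Inter>i<Suc p. (T ^^ i) -` Z i)" "\<forall>i<Suc p. Z i \<in> \<xi>"
    by (auto simp: cylinders_def)
  have "W = Z 0 \<inter> T -` (\<Inter>i<p. (T ^^ i) -` Z (Suc i))"
    unfolding Z(1) by (simp only: lessThan_Suc_eq_insert_0) (auto simp: funpow_swap1)
  moreover have "(\<Inter>i<p. (T ^^ i) -` Z (Suc i)) \<in> cylinders T \<xi> p"
    using Z(2) by (auto simp: cylinders_def)
  ultimately show "W \<in> (\<lambda>(Z, Y). Z \<inter> T -` Y) ` (\<xi> \<times> cylinders T \<xi> p)"
    using Z(2) by auto
next
  fix Z Y assume Z: "Z \<in> \<xi>" and "Y \<in> cylinders T \<xi> p"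
  then obtain Y' where Y': "Y = (\<Inter>i<p. (T ^^ i) -` Y' i)" "\<forall>i<p. Y' i \<in> \<xi>"
    by (auto simp: cylinders_def)
  have "Z \<inter> T -` Y = (\<Inter>i<Suc p. (T ^^ i) -` (case_nat Z Y' i))"
    unfolding Y'(1) by (simp only: lessThan_Suc_eq_insert_0) (auto simp: funpow_swap1)
  moreover have "\<forall>i<Suc p. case_nat Z Y' i \<in> \<xi>"
    using Z Y'(2) by (auto split: nat.split)
  ultimately show "Z \<inter> T -` Y \<in> cylinders T \<xi> (Suc p)"
    by (auto simp: cylinders_def)
qed

lemma cylinders_1: "cylinders T \<xi> (Suc 0) = \<xi>"
  by (auto simp: cylinders_Suc cylinders_0 image_iff)

text \<open>Each full block of \<open>N\<close> steps contributes a factor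
  \<open>\<theta> ^ N\<close>. The fewer than \<open>N\<close> steps left over contribute nothing,
  and the factor \<open>1 / \<theta> ^ N\<close> makes up for them.\<close>

lemma cylinders_dist_bound:
  fixes T :: "'a :: metric_space \<Rightarrow> 'a"
  assumes diam: "\<And>x y :: 'a. dist x y \<le> D" and "0 < \<theta>" "\<theta> < 1" and "N \<ge> 1"
    and exp: "\<And>W x y. W \<in> cylinders T \<xi> N \<Longrightarrow> x \<in> W \<Longrightarrow> y \<in> W
      \<Longrightarrow> dist x y \<le> \<theta> ^ N * dist ((T ^^ N) x) ((T ^^ N) y)"
    and "Y \<in> cylinders T \<xi> p" "x \<in> Y" "y \<in> Y"
  shows "dist x y \<le> D / \<theta> ^ N * \<theta> ^ p"
proof -
  have "0 \<le> D" using diam[of x x] by simp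
  \<comment> \<open>Stated for pairs of points with a common itinerary, so that the induction can
    pass to their images under \<open>T ^^ N\<close>.\<close>
  have "dist x y \<le> D / \<theta> ^ N * \<theta> ^ p"
    if "\<forall>i<p. \<exists>Z\<in>\<xi>. (T ^^ i) x \<in> Z \<and> (T ^^ i) y \<in> Z" for x y p
    using that
  proof (induction p arbitrary: x y rule: less_induct)
    case (less p)
    show ?case
    proof (cases "p < N")
      case True
      then have "\<theta> ^ N \<le> \<theta> ^ p" using assms by (intro power_decreasing) auto
      then have "D \<le> D / \<theta> ^ N * \<theta> ^ p"
        using \<open>0 < \<theta>\<close> \<open>0 \<le> D\<close> by (simp add: field_simps mult_left_mono)
      then show ?thesis using diam[of x y] by linarith
    next
      case False
      obtain Z where Z: "\<And>i. i < N \<Longrightarrow> Z i \<in> \<xi> \<and> (T ^^ i) x \<in> Z i \<and> (T ^^ i) y \<in> Z i"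
        using less.prems False by (metis less_le_trans not_less)
      have "(\<Inter>i<N. (T ^^ i) -` Z i) \<in> cylinders T \<xi> N"
        using Z by (auto simp: cylinders_def)
      then have 1: "dist x y \<le> \<theta> ^ N * dist ((T ^^ N) x) ((T ^^ N) y)"
        using Z by (intro exp) auto
      have "dist ((T ^^ N) x) ((T ^^ N) y) \<le> D / \<theta> ^ N * \<theta> ^ (p - N)"
      proof (rule less.IH)
        show "p - N < p" using False \<open>N \<ge> 1\<close> by simp
        show "\<forall>i<p - N. \<exists>Z\<in>\<xi>. (T ^^ i) ((T ^^ N) x) \<in> Z \<and> (T ^^ i) ((T ^^ N) y) \<in> Z"
        proof (intro allI impI)
          fix i assume "i < p - N"
          then show "\<exists>Z\<in>\<xi>. (T ^^ i) ((T ^^ N) x) \<in> Z \<and> (T ^^ i) ((T ^^ N) y) \<in> Z"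
            using less.prems[rule_format, of "i + N"] by (simp add: funpow_add)
        qed
      qed
      then have "\<theta> ^ N * dist ((T ^^ N) x) ((T ^^ N) y) \<le> \<theta> ^ N * (D / \<theta> ^ N * \<theta> ^ (p - N))"
        using \<open>0 < \<theta>\<close> by (intro mult_left_mono) auto
      also have "\<dots> = D / \<theta> ^ N * \<theta> ^ p"
        using power_diff[of \<theta> N p] False \<open>0 < \<theta>\<close> by simp
      finally show ?thesis using 1 by linarith
    qed
  qed
  moreover obtain Z where "Y = (\<Inter>i<p. (T ^^ i) -` Z i)" "\<forall>i<p. Z i \<in> \<xi>"
    using \<open>Y \<in> cylinders T \<xi> p\<close> by (auto simp: cylinders_def)
  then have "\<forall>i<p. \<exists>Z\<in>\<xi>. (T ^^ i) x \<in> Z \<and> (T ^^ i) y \<in> Z"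
    using \<open>x \<in> Y\<close> \<open>y \<in> Y\<close> by blast
  ultimately show ?thesis by blast
qed

text \<open>A product rule in terms of masses: two ratios are chained through the intermediate
  masses \<open>vE\<close> and \<open>vF\<close>, which may vanish. The case \<open>vE = 0\<close>
  is covered by \<open>null\<close>; otherwise \<open>v\<close> forces \<open>vF\<close> to be
  positive unless \<open>mF = 0\<close>.\<close>

lemma ratio_cancel:
  fixes a b :: real
  assumes "0 \<le> a" "0 \<le> b" "0 \<le> nF" "0 \<le> mE" "0 \<le> mF" "0 \<le> vE" "0 \<le> vF"
    and n: "nE * vF \<le> a * nF * vE" and v: "vE * mF \<le> b * vF * mE"
    and null: "vE = 0 \<Longrightarrow> nE = 0"
  shows "nE * mF \<le> a * b * nF * mE"
proof (cases "vE = 0 \<or> mF = 0")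
  case True
  then show ?thesis using null assms(1-5) by auto
next
  case False
  then have pos: "0 < vE" "0 < mF" using assms by auto
  with v have "0 < b * vF * mE" by (meson less_le_trans mult_pos_pos)
  then have "0 < vF" using \<open>0 \<le> vF\<close> by (metis less_eq_real_def mult_zero_left mult_zero_right less_irrefl)
  have "(nE * vF) * mF \<le> (a * nF * vE) * mF" using n pos by (intro mult_right_mono) auto
  also have "\<dots> = (a * nF) * (vE * mF)" by simp
  also have "\<dots> \<le> (a * nF) * (b * vF * mE)" using v assms by (intro mult_left_mono) auto
  finally have "vF * (nE * mF) \<le> vF * (a * b * nF * mE)" by (simp add: algebra_simps)
  then show ?thesis using \<open>0 < vF\<close> by simp
qed

lemma ennreal_products_le:
  assumes "ennreal a * ennreal b \<le> ennreal c * ennreal d * ennreal e"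
    and "0 \<le> a" "0 \<le> b" "0 \<le> c" "0 \<le> d" "0 \<le> e"
  shows "a * b \<le> c * d * e"
  using assms by (simp add: ennreal_mult[symmetric])

text \<open>The inequality in \<open>reg_on\<close> is closed in \<open>s\<close>: it holds with
  \<open>r + t\<close> for every \<open>t > 0\<close>, hence in the limit.\<close>

lemma reg_on_bound:
  assumes "reg_on B w \<le> ereal r" "x \<in> B" "y \<in> B" "0 \<le> w y"
  shows "w x \<le> (1 + r * dist x y) * w y"
proof -
  have le: "w x \<le> (1 + r * dist x y) * w y + t * (dist x y * w y)" if "0 < t" for t
  proof -
    have "reg_on B w < ereal (r + t)"
      using assms(1) that by (meson ereal_less_eq(3) le_less_trans less_add_same_cancel1 less_ereal.simps(1))
    then obtain s where s: "ereal s < ereal (r + t)" "\<forall>x\<in>B. \<forall>y\<in>B. w x \<le> (1 + s * dist x y) * w y"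
      unfolding reg_on_def by (auto simp: Inf_less_iff)
    have "w x \<le> (1 + s * dist x y) * w y" using s assms by blast
    also have "\<dots> \<le> (1 + (r + t) * dist x y) * w y"
      using s(1) \<open>0 \<le> w y\<close> by (intro mult_right_mono add_left_mono) auto
    finally show ?thesis by (simp add: algebra_simps)
  qed
  define q where "q = dist x y * w y"
  have "0 \<le> q" using assms by (simp add: q_def)
  show ?thesis
  proof (rule field_le_epsilon)
    fix e :: real assume "0 < e"
    \<comment> \<open>The choice \<open>t = e / (q + 1)\<close> keeps \<open>t * q\<close> at most
      \<open>e\<close>, also when \<open>q = 0\<close>.\<close>
    have "w x \<le> (1 + r * dist x y) * w y + e / (q + 1) * q"
      unfolding q_def using \<open>0 < e\<close> \<open>0 \<le> q\<close> by (intro le) (simp add: q_def add_nonneg_pos)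
    moreover have "e / (q + 1) * q \<le> e" using \<open>0 < e\<close> \<open>0 \<le> q\<close> by (simp add: field_simps)
    ultimately show "w x \<le> (1 + r * dist x y) * w y + e" by linarith
  qed
qed

lemma cylinders_SucE:
  assumes "W \<in> cylinders T \<xi> (Suc p)"
  obtains Z Y where "W = Z \<inter> T -` Y" "Z \<in> \<xi>" "Y \<in> cylinders T \<xi> p"
  using assms unfolding cylinders_Suc by (elim imageE SigmaE) (rule that; simp)

subsection \<open>Cylinders and partition-measurable sets\<close>

context piecewise_invertible
begin

lemma space_UNIV [simp]: "space M = UNIV"
  using sets_eq_imp_space_eq[OF sets_eq_borel] by simp

lemma vimage_T [measurable]: "E \<in> sets M \<Longrightarrow> T -` E \<in> sets M"
  using measurable_sets[OF T_measurable] by simp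

lemma measurable_funpow_T [measurable]: "T ^^ n \<in> measurable M M"
proof (induction n)
  case (Suc n)
  then show ?case using T_measurable by (auto intro: measurable_comp)
qed (simp add: id_def)

lemma vimage_funpow_T [measurable]: "E \<in> sets M \<Longrightarrow> (T ^^ n) -` E \<in> sets M"
  using measurable_sets[OF measurable_funpow_T] by simp

lemma measure_vimage_T: "E \<in> sets M \<Longrightarrow> measure M (T -` E) = measure M E"
  using measure_distr[OF T_measurable, of E] by (simp add: T_preserves)

lemma measure_vimage_funpow_T: "E \<in> sets M \<Longrightarrow> measure M ((T ^^ n) -` E) = measure M E"
proof (induction n arbitrary: E)
  case (Suc n)
  have "(T ^^ Suc n) -` E = T -` ((T ^^ n) -` E)"
    by (simp only: funpow_Suc_right vimage_comp)
  then show ?case using Suc by (simp add: measure_vimage_T del: funpow.simps)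
qed simp

lemma partition_sets [measurable]: "Z \<in> \<xi> \<Longrightarrow> Z \<in> sets M"
  using open_partition by (simp add: sets_eq_borel)

lemma cylinders_sets: "Y \<in> cylinders T \<xi> p \<Longrightarrow> Y \<in> sets M"
proof (induction p arbitrary: Y)
  case 0
  then show ?case using sets.top[of M] by (auto simp: cylinders_0)
next
  case (Suc p)
  then show ?case by (auto simp: cylinders_Suc)
qed

lemma countable_cylinders: "countable (cylinders T \<xi> p)"
  by (induction p) (auto simp: cylinders_0 cylinders_Suc countable_partition)

lemma disjoint_cylinders: "disjoint (cylinders T \<xi> p)"
proof (induction p)
  case 0
  then show ?case by (simp add: cylinders_0)
next
  case (Suc p)
  show ?case
  proof (rule disjointI)
    fix V W assume "V \<in> cylinders T \<xi> (Suc p)" "W \<in> cylinders T \<xi> (Suc p)" and "V \<noteq> W"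
    then obtain Z Y Z' Y' where V: "V = Z \<inter> T -` Y" "Z \<in> \<xi>" "Y \<in> cylinders T \<xi> p"
      and W: "W = Z' \<inter> T -` Y'" "Z' \<in> \<xi>" "Y' \<in> cylinders T \<xi> p"
      by (meson cylinders_SucE)
    then have "Z \<noteq> Z' \<or> Y \<noteq> Y'" using \<open>V \<noteq> W\<close> by blast
    then have "Z \<inter> Z' = {} \<or> Y \<inter> Y' = {}"
      using disjoint_partition Suc V W by (auto dest: disjointD)
    then show "V \<inter> W = {}" unfolding V W by blast
  qed
qed

lemma cylinders_subset: "Y \<in> cylinders T \<xi> (Suc p) \<Longrightarrow> \<exists>Z\<in>\<xi>. Y \<subseteq> Z"
  by (auto simp: cylinders_Suc)

lemma AE_T: "AE x in M. P x \<Longrightarrow> AE x in M. P (T x)"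
  by (metis AE_distrD T_measurable T_preserves)

lemma cylinders_cover: "AE x in M. x \<in> \<Union>(cylinders T \<xi> p)"
proof (induction p)
  case 0
  then show ?case by (simp add: cylinders_0)
next
  case (Suc p)
  show ?case using covers_AE AE_T[OF Suc] by eventually_elim (unfold cylinders_Suc, blast)
qed

lemma partition_measurable_sets: "partition_measurable M \<xi> D \<Longrightarrow> D \<in> sets M"
  by (simp add: partition_measurable_def)

lemma partition_measurable_UNIV: "partition_measurable M \<xi> UNIV"
  using covers_AE sets.top[of M] by (auto simp: partition_measurable_def intro!: exI[of _ \<xi>])

lemma partition_measurable_element: "Z \<in> \<xi> \<Longrightarrow> partition_measurable M \<xi> Z"
  by (auto simp: partition_measurable_def intro!: exI[of _ "{Z}"])

lemma partition_measurable_Compl: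
  assumes "partition_measurable M \<xi> D"
  shows "partition_measurable M \<xi> (- D)"
proof -
  from assms obtain \<eta> where \<eta>: "\<eta> \<subseteq> \<xi>" "AE x in M. x \<in> D \<longleftrightarrow> x \<in> \<Union>\<eta>" and D: "D \<in> sets M"
    by (auto simp: partition_measurable_def)
  have "AE x in M. x \<in> - D \<longleftrightarrow> x \<in> \<Union>(\<xi> - \<eta>)"
    using \<eta>(2) covers_AE
  proof eventually_elim
    case (elim x)
    then show ?case using \<eta>(1) disjointD[OF disjoint_partition] by blast
  qed
  moreover have "- D \<in> sets M" using sets.compl_sets[OF D] by (simp add: Compl_eq_Diff_UNIV)
  ultimately show ?thesis
    unfolding partition_measurable_def by (intro conjI exI[of _ "\<xi> - \<eta>"]) auto
qed

lemma partition_measurable_cases: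
  assumes "partition_measurable M \<xi> D" "Z \<in> \<xi>"
  shows "(AE x in M. x \<in> Z \<longrightarrow> x \<in> D) \<or> (AE x in M. x \<in> Z \<longrightarrow> x \<notin> D)"
proof -
  from assms obtain \<eta> where \<eta>: "\<eta> \<subseteq> \<xi>" and ae: "AE x in M. x \<in> D \<longleftrightarrow> x \<in> \<Union>\<eta>"
    by (auto simp: partition_measurable_def)
  show ?thesis
  proof (cases "Z \<in> \<eta>")
    case True
    then show ?thesis using ae by (intro disjI1) (auto elim!: eventually_mono)
  next
    case False
    then have "Z \<inter> \<Union>\<eta> = {}" using \<eta> \<open>Z \<in> \<xi>\<close> disjointD[OF disjoint_partition] by blast
    then show ?thesis using ae by (intro disjI2) (auto elim!: eventually_mono)
  qed
qed

text \<open>On densities \<open>u\<close>, this is the transfer operator applied to \<open>1\<^sub>D u\<close>.\<close>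

definition push :: "'a set \<Rightarrow> 'a measure \<Rightarrow> 'a measure" where
  "push D \<nu> = distr (density \<nu> (indicator D)) M T"

lemma sets_push [simp]: "sets (push D \<nu>) = sets M"
  by (simp add: push_def)


lemma emeasure_push:
  assumes "sets \<nu> = sets M" "D \<in> sets M" "E \<in> sets M"
  shows "emeasure (push D \<nu>) E = emeasure \<nu> (D \<inter> T -` E)"
proof -
  have [simp]: "space \<nu> = UNIV" using sets_eq_imp_space_eq[OF assms(1)] by simp
  have "T \<in> measurable (density \<nu> (indicator D)) M"
    using T_measurable assms(1) by (simp cong: measurable_cong_sets)
  then show ?thesis
    using assms by (simp add: push_def emeasure_distr emeasure_restricted)
qed

lemma measure_push:
  assumes "sets \<nu> = sets M" "D \<in> sets M" "E \<in> sets M"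
  shows "measure (push D \<nu>) E = measure \<nu> (D \<inter> T -` E)"
  using emeasure_push[OF assms] by (simp add: measure_def)

end

context markov_system
begin

text \<open>By the Markov property an image contains \<open>Z\<close> or meets it in a null set, and
  countably many images leave one common null set. Hence almost all points of \<open>Z\<close> lie
  in a single element of the partition \<beta>, on which the densities are controlled.\<close>

lemma AE_image_membership:
  assumes "Z \<in> \<xi>"
  shows "AE x in M. x \<in> Z \<longrightarrow> (\<forall>Z'\<in>\<xi>. x \<in> T ` Z' \<longleftrightarrow> Z \<subseteq> T ` Z')"
proof -
  have "AE x in M. \<forall>Z'\<in>\<xi>. x \<in> Z \<longrightarrow> (x \<in> T ` Z' \<longleftrightarrow> Z \<subseteq> T ` Z')"
  proof (subst AE_ball_countable[OF countable_partition], intro ballI)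
    fix Z' assume Z': "Z' \<in> \<xi>"
    show "AE x in M. x \<in> Z \<longrightarrow> (x \<in> T ` Z' \<longleftrightarrow> Z \<subseteq> T ` Z')"
    proof (cases "Z \<subseteq> T ` Z'")
      case True
      then show ?thesis by auto
    next
      case False
      then have "measure M (T ` Z' \<inter> Z) = 0"
        using markov[OF Z' assms] zero_less_measure_iff by blast
      then have "T ` Z' \<inter> Z \<in> null_sets M"
        using image_measurable[OF Z'] assms by (intro null_setsI) (auto simp: emeasure_eq_measure)
      then have "AE x in M. x \<notin> T ` Z' \<inter> Z" by (rule AE_not_in)
      then show ?thesis using False by eventually_elim auto
    qed
  qed
  then show ?thesis by eventually_elim blast
qed

end

subsection \<open>Regular measures\<close>

text \<open>Collects the quantitative content of the Gibbs-Markov conditions: contraction at every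
  rank for \<open>T\<close> itself, although only an iterate expands; images of mass at least
  \<open>c\<close>; distortion of the branches as a ratio of masses.\<close>

locale bounded_distortion = markov_system M T \<xi>
  for M :: "'a :: metric_space measure" and T :: "'a \<Rightarrow> 'a" and \<xi> :: "'a set set" +
  fixes \<theta> \<Delta> L c \<kappa> :: real
  assumes theta: "0 < \<theta>" "\<theta> < 1"
    and L_nonneg: "0 \<le> L"
    and c_pos: "0 < c"
    \<comment> \<open>makes regularity invariant under transport by \<open>T\<close>\<close>
    and kappa: "L * \<Delta> \<le> (1 - \<theta>) * \<kappa>"
    and cylinder_dist: "\<And>p Y x y. Y \<in> cylinders T \<xi> p \<Longrightarrow> x \<in> Y \<Longrightarrow> y \<in> Y \<Longrightarrow> dist x y \<le> \<Delta> * \<theta> ^ p"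
    and image_lower_bound: "\<And>Z. Z \<in> \<xi> \<Longrightarrow> c \<le> measure M (T ` Z)"
    and branch_distortion: "\<And>Z E F D. Z \<in> \<xi> \<Longrightarrow> E \<in> sets M \<Longrightarrow> F \<in> sets M
      \<Longrightarrow> E \<subseteq> T ` Z \<Longrightarrow> F \<subseteq> T ` Z \<Longrightarrow> (\<And>x y. x \<in> E \<Longrightarrow> y \<in> F \<Longrightarrow> dist x y \<le> D) \<Longrightarrow> 0 \<le> D
      \<Longrightarrow> measure M (Z \<inter> T -` E) * measure M F \<le> (1 + L * D) * measure M (Z \<inter> T -` F) * measure M E"

context bounded_distortion
begin

text \<open>Distances are replaced by \<open>\<theta>\<close> to the power of the separation time: if only an iterate of \<open>T\<close>
  is expanding, an inverse branch need not be Lipschitz for the metric. Comparing masses of sets instead of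
  values of a density avoids the choice of versions.\<close>

definition regular :: "'a measure \<Rightarrow> bool" where
  "regular \<nu> \<longleftrightarrow> finite_measure \<nu> \<and> sets \<nu> = sets M \<and> absolutely_continuous M \<nu> \<and>
    (\<forall>p Y E F. Y \<in> cylinders T \<xi> (Suc p) \<and> E \<in> sets M \<and> F \<in> sets M \<and> E \<subseteq> Y \<and> F \<subseteq> Y \<longrightarrow>
      measure \<nu> E * measure M F \<le> exp (\<kappa> * \<theta> ^ Suc p) * measure \<nu> F * measure M E)"

lemma Delta_nonneg: "0 \<le> \<Delta>"
  using cylinder_dist[of UNIV 0 undefined undefined] by (simp add: cylinders_0)

lemma kappa_nonneg: "0 \<le> \<kappa>"
proof -
  have "0 \<le> (1 - \<theta>) * \<kappa>" using kappa L_nonneg Delta_nonneg by (meson mult_nonneg_nonneg order_trans)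
  then show ?thesis using theta by (simp add: zero_le_mult_iff)
qed

lemma regularD:
  assumes "regular \<nu>"
  shows "finite_measure \<nu>" "sets \<nu> = sets M" "space \<nu> = UNIV" "absolutely_continuous M \<nu>"
  using assms sets_eq_imp_space_eq[of \<nu> M] by (auto simp: regular_def)

lemma regular_ratio:
  assumes "regular \<nu>" "Y \<in> cylinders T \<xi> (Suc p)" "E \<in> sets M" "F \<in> sets M" "E \<subseteq> Y" "F \<subseteq> Y"
  shows "measure \<nu> E * measure M F \<le> exp (\<kappa> * \<theta> ^ Suc p) * measure \<nu> F * measure M E"
  using assms unfolding regular_def by blast

lemma regular_AE: "regular \<nu> \<Longrightarrow> AE x in M. P x \<Longrightarrow> AE x in \<nu>. P x"
  using absolutely_continuous_AE[of \<nu> M P] by (simp add: regularD)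

lemma regular_null:
  assumes "regular \<nu>" "E \<in> sets M" "measure M E = 0"
  shows "measure \<nu> E = 0"
proof -
  have "E \<in> null_sets M" using assms by (intro null_setsI) (auto simp: emeasure_eq_measure)
  then have "E \<in> null_sets \<nu>" using regularD(4)[OF assms(1)] by (auto simp: absolutely_continuous_def)
  then show ?thesis by (simp add: measure_def null_setsD1)
qed

lemma regular_self: "regular M"
  unfolding regular_def
proof (intro conjI allI impI)
  show "absolutely_continuous M M" by (simp add: absolutely_continuous_def)
  fix p Y E F
  have "1 \<le> exp (\<kappa> * \<theta> ^ Suc p)" using kappa_nonneg theta by simp
  then have "1 * (prob E * prob F) \<le> exp (\<kappa> * \<theta> ^ Suc p) * (prob E * prob F)"
    by (rule mult_right_mono) simp
  then show "prob E * prob F \<le> exp (\<kappa> * \<theta> ^ Suc p) * prob F * prob E"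
    by (simp add: algebra_simps)
qed (simp_all add: finite_measure_axioms)

text \<open>A cylinder of positive rank lies in one element of \<open>\<xi>\<close>, and
  \<open>D\<close> contains or misses that element up to a null set. So restriction either keeps all
  masses inside the cylinder or makes all of them vanish.\<close>

lemma regular_restrict:
  assumes \<nu>: "regular \<nu>" and D: "partition_measurable M \<xi> D"
  shows "regular (density \<nu> (indicator D))"
proof -
  interpret \<nu>: finite_measure \<nu> using regularD[OF \<nu>] by simp
  note [simp] = regularD(2,3)[OF \<nu>]
  have D': "D \<in> sets M" using D by (rule partition_measurable_sets)
  have em: "emeasure (density \<nu> (indicator D)) E = emeasure \<nu> (D \<inter> E)" if "E \<in> sets M" for E
    using that D' by (simp add: emeasure_restricted)
  have m: "measure (density \<nu> (indicator D)) E = measure \<nu> (D \<inter> E)" if "E \<in> sets M" for E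
    using em[OF that] by (simp add: measure_def)
  show ?thesis
    unfolding regular_def
  proof (intro conjI allI impI, goal_cases)
    case 1
    show ?case
      by (rule finite_measureI) (use em[OF sets.top] in \<open>simp add: \<nu>.emeasure_eq_measure\<close>)
  next
    case 2
    show ?case by simp
  next
    case 3
    show ?case
      unfolding absolutely_continuous_def
    proof
      fix N assume N: "N \<in> null_sets M"
      then have "N \<in> null_sets \<nu>" using regularD(4)[OF \<nu>] by (auto simp: absolutely_continuous_def)
      then have "D \<inter> N \<in> null_sets \<nu>" using D' by (intro null_set_Int1) auto
      then show "N \<in> null_sets (density \<nu> (indicator D))"
        using em[of N] N by (intro null_setsI) (auto simp: null_sets_def)
    qed
  next
    case (4 p Y E F)
    then obtain Z where "Z \<in> \<xi>" "Y \<subseteq> Z" using cylinders_subset by blast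
    from partition_measurable_cases[OF D this(1)] show ?case
    proof
      assume "AE x in M. x \<in> Z \<longrightarrow> x \<in> D"
      then have ae: "AE x in \<nu>. x \<in> Z \<longrightarrow> x \<in> D" by (rule regular_AE[OF \<nu>])
      have "measure \<nu> (D \<inter> E) = measure \<nu> E" "measure \<nu> (D \<inter> F) = measure \<nu> F"
        using ae 4 \<open>Y \<subseteq> Z\<close> D' by (auto intro!: \<nu>.finite_measure_eq_AE elim!: eventually_mono)
      then show ?thesis using 4 regular_ratio[OF \<nu>, of Y p E F] by (simp add: m)
    next
      assume "AE x in M. x \<in> Z \<longrightarrow> x \<notin> D"
      then have ae: "AE x in \<nu>. x \<in> Z \<longrightarrow> x \<notin> D" by (rule regular_AE[OF \<nu>])
      have "measure \<nu> (D \<inter> E) = measure \<nu> {}"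
        using ae 4 \<open>Y \<subseteq> Z\<close> D' by (intro \<nu>.finite_measure_eq_AE) (auto elim!: eventually_mono)
      then show ?thesis using 4 by (simp add: m)
    qed
  qed
qed

text \<open>The element of \<open>\<xi>\<close> around \<open>Y\<close> is not contained in the
  image of \<open>Z\<close>, so it meets that image in a null set. Comparison with the whole image,
  whose mass is at least \<open>c\<close>, makes the preimage null as well.\<close>

lemma markov_cylinder:
  assumes "Z \<in> \<xi>" "Y \<in> cylinders T \<xi> (Suc p)" "\<not> Y \<subseteq> T ` Z"
  shows "measure M (Z \<inter> T -` Y) = 0"
proof -
  obtain Z' where Z': "Z' \<in> \<xi>" "Y \<subseteq> Z'" using assms cylinders_subset by blast
  then have "\<not> Z' \<subseteq> T ` Z" using assms by blast
  then have 0: "measure M (T ` Z \<inter> Z') = 0"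
    using markov[OF assms(1) Z'(1)] zero_less_measure_iff by blast
  have sets: "T ` Z \<inter> Z' \<in> sets M" "T ` Z \<in> sets M" using image_measurable assms Z' by auto
  have "measure M (Z \<inter> T -` (T ` Z \<inter> Z')) * measure M (T ` Z)
      \<le> (1 + L * \<Delta>) * measure M (Z \<inter> T -` T ` Z) * measure M (T ` Z \<inter> Z')"
    using branch_distortion[OF assms(1) sets] cylinder_dist[of UNIV 0] Delta_nonneg by (simp add: cylinders_0)
  then have "measure M (Z \<inter> T -` (T ` Z \<inter> Z')) * measure M (T ` Z) \<le> 0" using 0 by simp
  moreover have "0 < measure M (T ` Z)" using image_lower_bound[OF assms(1)] c_pos by simp
  ultimately have "measure M (Z \<inter> T -` (T ` Z \<inter> Z')) \<le> 0" by (simp add: mult_le_0_iff)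
  moreover have "measure M (Z \<inter> T -` Y) \<le> measure M (Z \<inter> T -` (T ` Z \<inter> Z'))"
    using Z' sets assms(1) by (intro finite_measure_mono) auto
  ultimately show ?thesis using measure_nonneg[of M "Z \<inter> T -` Y"] by linarith
qed

text \<open>Regularity relates the masses of the preimages under \<open>\<nu>\<close> to those under
  the invariant measure; the distortion of the branch relates the latter to the masses of
  \<open>E\<close> and \<open>F\<close>.\<close>

lemma branch_ratio:
  assumes \<nu>: "regular \<nu>" and Z: "Z \<in> \<xi>" and W: "W \<in> cylinders T \<xi> (Suc p)" "Z \<inter> T -` E \<subseteq> W" "Z \<inter> T -` F \<subseteq> W"
    and sets: "E \<in> sets M" "F \<in> sets M" and sub: "E \<subseteq> T ` Z" "F \<subseteq> T ` Z"
    and D: "\<And>x y. x \<in> E \<Longrightarrow> y \<in> F \<Longrightarrow> dist x y \<le> D" "0 \<le> D"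
  shows "measure \<nu> (Z \<inter> T -` E) * measure M F
    \<le> exp (\<kappa> * \<theta> ^ Suc p) * (1 + L * D) * measure \<nu> (Z \<inter> T -` F) * measure M E"
proof (rule ratio_cancel)
  show "measure \<nu> (Z \<inter> T -` E) * measure M (Z \<inter> T -` F)
      \<le> exp (\<kappa> * \<theta> ^ Suc p) * measure \<nu> (Z \<inter> T -` F) * measure M (Z \<inter> T -` E)"
    using W sets Z by (intro regular_ratio[OF \<nu> W(1)]) auto
  show "measure M (Z \<inter> T -` E) * measure M F \<le> (1 + L * D) * measure M (Z \<inter> T -` F) * measure M E"
    using branch_distortion[OF Z sets sub D] by simp
  show "measure \<nu> (Z \<inter> T -` E) = 0" if "measure M (Z \<inter> T -` E) = 0"
    using that regular_null[OF \<nu>] sets Z by simp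
qed (use L_nonneg D in auto)

text \<open>The preimage of \<open>Y\<close> in a branch is a cylinder of one rank more, so
  \<open>\<nu>\<close> uses only \<open>\<kappa> * \<theta> ^ Suc (Suc p)\<close> of the exponent.
  By \<open>kappa\<close> the distortion of the branch, with exponent at most
  \<open>L * \<Delta> * \<theta> ^ Suc p\<close>, fits into the rest. Branches whose image does not
  contain \<open>Y\<close> carry no mass over \<open>Y\<close>.\<close>

lemma regular_distr:
  assumes \<nu>: "regular \<nu>"
  shows "regular (distr \<nu> M T)"
proof -
  interpret \<nu>: finite_measure \<nu> using regularD[OF \<nu>] by simp
  note [simp] = regularD(2,3)[OF \<nu>]
  have T: "T \<in> measurable \<nu> M" using T_measurable by (simp cong: measurable_cong_sets)
  have m: "measure (distr \<nu> M T) E = measure \<nu> (T -` E)" if "E \<in> sets M" for E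
    using that by (simp add: measure_distr[OF T])
  show ?thesis
    unfolding regular_def
  proof (intro conjI allI impI, goal_cases)
    case 1
    show ?case using T by (rule \<nu>.finite_measure_distr)
  next
    case 2
    show ?case by simp
  next
    case 3
    show ?case
      unfolding absolutely_continuous_def
    proof
      fix N assume N: "N \<in> null_sets M"
      then have "N \<in> sets M" "measure M N = 0" by (auto simp: measure_def)
      then have "T -` N \<in> sets M" "measure M (T -` N) = 0" by (auto simp: measure_vimage_T)
      then have "measure \<nu> (T -` N) = 0" by (intro regular_null[OF \<nu>]) auto
      then show "N \<in> null_sets (distr \<nu> M T)"
        using \<open>N \<in> sets M\<close> by (intro null_setsI) (simp_all add: emeasure_distr[OF T] \<nu>.emeasure_eq_measure)
    qed
  next
    case (4 p Y E F)
    then have Y: "Y \<in> cylinders T \<xi> (Suc p)" and sets: "E \<in> sets M" "F \<in> sets M"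
      and sub: "E \<subseteq> Y" "F \<subseteq> Y" by auto
    let ?e = "exp (\<kappa> * \<theta> ^ Suc p)"
    show ?case
    proof (cases "measure M F = 0")
      case True
      then show ?thesis by simp
    next
      case False
      then have F: "0 < measure M F" using zero_less_measure_iff by blast
      have "measure \<nu> (T -` E) \<le> (?e * measure M E / measure M F) * measure \<nu> (T -` F)"
      proof (rule \<nu>.measure_le_of_countable_cover[of \<xi>])
        fix Z assume Z: "Z \<in> \<xi>"
        have sZ: "Z \<inter> T -` E \<in> sets M" "Z \<inter> T -` Y \<in> sets M"
          using Z sets cylinders_sets[OF Y] by auto
        show "measure \<nu> (Z \<inter> T -` E) \<le> (?e * measure M E / measure M F) * measure \<nu> (Z \<inter> T -` F)"
        proof (cases "Y \<subseteq> T ` Z")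
          case True
          define W where "W = Z \<inter> T -` Y"
          have W: "W \<in> cylinders T \<xi> (Suc (Suc p))" using Z Y by (auto simp: W_def cylinders_Suc[of _ _ "Suc p"])
          have "1 + L * (\<Delta> * \<theta> ^ Suc p) \<le> exp (L * (\<Delta> * \<theta> ^ Suc p))" by (rule exp_ge_add_one_self)
          also have "\<dots> \<le> exp ((1 - \<theta>) * \<kappa> * \<theta> ^ Suc p)"
            using mult_right_mono[OF kappa, of "\<theta> ^ Suc p"] theta by (simp add: mult.assoc)
          finally have "exp (\<kappa> * \<theta> ^ Suc (Suc p)) * (1 + L * (\<Delta> * \<theta> ^ Suc p))
              \<le> exp (\<kappa> * \<theta> ^ Suc (Suc p)) * exp ((1 - \<theta>) * \<kappa> * \<theta> ^ Suc p)"
            by (rule mult_left_mono) simp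
          also have "\<dots> = ?e" by (simp add: exp_add[symmetric] algebra_simps)
          finally have e: "exp (\<kappa> * \<theta> ^ Suc (Suc p)) * (1 + L * (\<Delta> * \<theta> ^ Suc p)) \<le> ?e" .
          have "dist x y \<le> \<Delta> * \<theta> ^ Suc p" if "x \<in> E" "y \<in> F" for x y
            using that sub by (intro cylinder_dist[OF Y]) auto
          then have "measure \<nu> (Z \<inter> T -` E) * measure M F
              \<le> exp (\<kappa> * \<theta> ^ Suc (Suc p)) * (1 + L * (\<Delta> * \<theta> ^ Suc p)) * measure \<nu> (Z \<inter> T -` F) * measure M E"
            using True sub sets Delta_nonneg theta
            by (intro branch_ratio[OF \<nu> Z W]) (auto simp: W_def simp del: power_Suc)
          also have "\<dots> \<le> ?e * measure \<nu> (Z \<inter> T -` F) * measure M E"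
            using e by (intro mult_right_mono) auto
          finally show ?thesis using F by (simp add: field_simps)
        next
          case False
          then have "measure \<nu> (Z \<inter> T -` Y) = 0"
            using markov_cylinder[OF Z Y] regular_null[OF \<nu>] sZ by simp
          moreover have "measure \<nu> (Z \<inter> T -` E) \<le> measure \<nu> (Z \<inter> T -` Y)"
            using sub sZ by (intro \<nu>.finite_measure_mono) auto
          ultimately show ?thesis by (smt (verit) F divide_nonneg_pos exp_gt_zero measure_nonneg mult_nonneg_nonneg)
        qed
      qed (use countable_partition disjoint_partition covers_AE sets F regular_AE[OF \<nu>] in auto)
      then show ?thesis using F sets by (simp add: m field_simps)
    qed
  qed
qed

lemma regular_push: "regular \<nu> \<Longrightarrow> partition_measurable M \<xi> D \<Longrightarrow> regular (push D \<nu>)"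
  unfolding push_def by (intro regular_distr regular_restrict)

section \<open>Bounded density after transport\<close>

definition K :: real where
  "K = exp \<kappa> * (1 + L * \<Delta>) / c"

lemma K_pos: "0 < K"
  using L_nonneg Delta_nonneg c_pos by (auto simp: K_def intro!: divide_pos_pos mult_pos_pos add_pos_nonneg)

text \<open>Comparing \<open>E\<close> with the whole image of \<open>Z\<close>: the mass is spread
  over a set of measure at least \<open>c\<close> with bounded distortion. Accordingly
  \<open>K\<close> is the distortion over a full branch divided by the least mass of an
  image.\<close>

lemma branch_mass_bound:
  assumes \<nu>: "regular \<nu>" and Z: "Z \<in> \<xi>" and E: "E \<in> sets M"
  shows "measure \<nu> (Z \<inter> T -` E) \<le> K * measure \<nu> Z * measure M E"
proof -
  interpret \<nu>: finite_measure \<nu> using regularD[OF \<nu>] by simp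
  note [simp] = regularD(2,3)[OF \<nu>]
  have TZ: "T ` Z \<in> sets M" using image_measurable Z by simp
  have Z_eq: "Z \<inter> T -` (E \<inter> T ` Z) = Z \<inter> T -` E" "Z \<inter> T -` (T ` Z) = Z" by auto
  have "measure \<nu> (Z \<inter> T -` E) * c \<le> measure \<nu> (Z \<inter> T -` E) * measure M (T ` Z)"
    using image_lower_bound[OF Z] by (intro mult_left_mono) auto
  also have "\<dots> \<le> exp (\<kappa> * \<theta> ^ Suc 0) * (1 + L * \<Delta>) * measure \<nu> Z * measure M (E \<inter> T ` Z)"
    using branch_ratio[OF \<nu> Z, of Z 0 "E \<inter> T ` Z" "T ` Z" \<Delta>] E TZ Z cylinder_dist[of UNIV 0] Delta_nonneg
    unfolding Z_eq by (simp add: cylinders_0 cylinders_1)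
  also have "\<dots> \<le> exp \<kappa> * (1 + L * \<Delta>) * measure \<nu> Z * measure M E"
    using E TZ L_nonneg Delta_nonneg kappa_nonneg theta mult_left_le[of \<theta> \<kappa>]
    by (intro mult_mono finite_measure_mono mult_nonneg_nonneg) auto
  finally show ?thesis using c_pos by (simp add: K_def field_simps)
qed

text \<open>Only the last step costs a factor \<open>K\<close>. Before that the mass is carried
  along by \<open>push\<close>, which keeps it regular with the same \<open>\<kappa>\<close>, so the
  constant does not grow with the rank.\<close>

lemma cylinder_mass_bound:
  assumes "regular \<nu>" "W \<in> cylinders T \<xi> (Suc p)" "E \<in> sets M"
  shows "measure \<nu> (W \<inter> (T ^^ Suc p) -` E) \<le> K * measure \<nu> W * measure M E"
  using assms
proof (induction p arbitrary: \<nu> W)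
  case 0
  then show ?case using branch_mass_bound by (simp add: cylinders_1)
next
  case (Suc p)
  obtain Z Y where W: "W = Z \<inter> T -` Y" "Z \<in> \<xi>" "Y \<in> cylinders T \<xi> (Suc p)"
    using Suc.prems(2) by (rule cylinders_SucE)
  have Y: "Y \<in> sets M" "Z \<in> sets M" using W cylinders_sets by auto
  have "measure (push Z \<nu>) (Y \<inter> (T ^^ Suc p) -` E) \<le> K * measure (push Z \<nu>) Y * measure M E"
    using Suc W by (intro Suc.IH regular_push partition_measurable_element) auto
  moreover have "W \<inter> (T ^^ Suc (Suc p)) -` E = Z \<inter> T -` (Y \<inter> (T ^^ Suc p) -` E)"
    unfolding W funpow_Suc_right[of "Suc p"] by auto
  moreover have "Y \<inter> (T ^^ Suc p) -` E \<in> sets M" using Y vimage_funpow_T Suc.prems(3) by blast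
  ultimately show ?case
    using Y W regularD[OF Suc.prems(1)] by (simp add: measure_push del: funpow.simps)
qed

lemma union_of_cylinders_mass_bound:
  assumes \<nu>: "regular \<nu>" and D: "D \<in> sets M" and E: "E \<in> sets M"
    and cases: "\<And>W. W \<in> cylinders T \<xi> (Suc p) \<Longrightarrow> W \<subseteq> D \<or> W \<inter> D = {}"
  shows "measure \<nu> (D \<inter> (T ^^ Suc p) -` E) \<le> K * measure \<nu> D * measure M E"
proof -
  interpret \<nu>: finite_measure \<nu> using regularD[OF \<nu>] by simp
  note [simp] = regularD(2,3)[OF \<nu>]
  have TE: "(T ^^ Suc p) -` E \<in> sets M" using E by (rule vimage_funpow_T)
  have "measure \<nu> (D \<inter> (T ^^ Suc p) -` E) \<le> (K * measure M E) * measure \<nu> D"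
  proof (rule \<nu>.measure_le_of_countable_cover[of "cylinders T \<xi> (Suc p)"])
    fix W assume W: "W \<in> cylinders T \<xi> (Suc p)"
    from cases[OF W] show "measure \<nu> (W \<inter> (D \<inter> (T ^^ Suc p) -` E))
        \<le> (K * measure M E) * measure \<nu> (W \<inter> D)"
    proof
      assume "W \<subseteq> D"
      then have "W \<inter> (D \<inter> (T ^^ Suc p) -` E) = W \<inter> (T ^^ Suc p) -` E" "W \<inter> D = W" by auto
      then show ?thesis using cylinder_mass_bound[OF \<nu> W E] by (simp add: algebra_simps)
    next
      assume "W \<inter> D = {}"
      then have "W \<inter> (D \<inter> (T ^^ Suc p) -` E) = {}" "W \<inter> D = {}" by auto
      then show ?thesis by simp
    qed
  qed (use D TE countable_cylinders disjoint_cylinders regular_AE[OF \<nu> cylinders_cover]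
        K_pos cylinders_sets in auto)
  then show ?thesis by (simp add: algebra_simps)
qed

lemma push_bound:
  assumes \<nu>: "regular \<nu>" and D: "partition_measurable M \<xi> D" and E: "E \<in> sets M"
  shows "measure (push D \<nu>) E \<le> K * measure \<nu> D * measure M E"
proof -
  note [simp] = regularD(2,3)[OF \<nu>]
  have D': "D \<in> sets M" using D by (rule partition_measurable_sets)
  \<comment> \<open>\<open>D\<close> agrees with a union of elements of \<open>\<xi>\<close> only up
    to a null set, so \<open>\<nu>\<close> is restricted to \<open>D\<close> first and the bound is
    applied to \<open>UNIV\<close>.\<close>
  have "measure (density \<nu> (indicator D)) (UNIV \<inter> (T ^^ Suc 0) -` E)
      \<le> K * measure (density \<nu> (indicator D)) UNIV * measure M E"
    using E sets.top[of M] by (intro union_of_cylinders_mass_bound regular_restrict \<nu> D) auto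
  then show ?thesis
    unfolding measure_push[OF regularD(2)[OF \<nu>] D' E]
    using D' E sets.top[of M] by (simp add: measure_def emeasure_restricted)
qed


subsection \<open>Uniform mixing of regular measures\<close>

text \<open>Taken relative to the total mass, since the measures that occur later lose mass at every
  step.\<close>

definition bounded_density :: "'a measure \<Rightarrow> bool" where
  "bounded_density \<nu> \<longleftrightarrow> (\<forall>E\<in>sets M. measure \<nu> E \<le> K * measure \<nu> UNIV * measure M E)"

lemma bounded_densityD:
  "bounded_density \<nu> \<Longrightarrow> E \<in> sets M \<Longrightarrow> measure \<nu> E \<le> K * measure \<nu> UNIV * measure M E"
  by (simp add: bounded_density_def)

lemma bounded_density_push:
  assumes \<nu>: "regular \<nu>" and D: "partition_measurable M \<xi> D"
  shows "bounded_density (push D \<nu>)"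
  unfolding bounded_density_def
  using push_bound[OF \<nu> D] measure_push[OF regularD(2)[OF \<nu>] partition_measurable_sets[OF D] sets.top]
  by simp

lemma Compl_sets: "E \<in> sets M \<Longrightarrow> - E \<in> sets M"
  using sets.compl_sets[of E M] by (simp add: Compl_eq_Diff_UNIV)

text \<open>Continuity from below along an enumeration of the cylinders. A finite family is wanted
  because mixing provides a rate for one set at a time only.\<close>

lemma finite_cylinder_family:
  assumes "0 < \<eta>"
  obtains F where "finite F" "F \<subseteq> cylinders T \<xi> p" "measure M (- \<Union>F) \<le> \<eta>"
proof -
  let ?C = "cylinders T \<xi> p"
  have ne: "?C \<noteq> {}"
  proof
    assume "?C = {}"
    then have "AE x in M. False" using cylinders_cover[of p] by simp
    then show False by simp
  qed
  define f where "f = from_nat_into ?C"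
  have f: "range f = ?C"
    using range_from_nat_into[OF ne countable_cylinders] by (simp add: f_def)
  define U where "U n = (\<Union>i<n. f i)" for n
  have fs: "f i \<in> sets M" for i using f cylinders_sets by blast
  have "(\<lambda>n. measure M (U n)) \<longlonglongrightarrow> measure M (\<Union>n. U n)"
  proof (rule finite_Lim_measure_incseq)
    show "incseq U" unfolding incseq_def U_def by (intro allI impI UN_mono) auto
  qed (use fs in \<open>auto simp: U_def\<close>)
  moreover have "(\<Union>n. U n) = \<Union>?C" unfolding U_def f[symmetric] by auto
  moreover have "measure M (\<Union>?C) = 1"
    using cylinders_cover[of p] countable_cylinders cylinders_sets
    by (subst prob_eq_1) (auto intro!: sets.countable_Union)
  ultimately have "eventually (\<lambda>n. 1 - \<eta> < measure M (U n)) sequentially"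
    using \<open>0 < \<eta>\<close> by (intro order_tendstoD) auto
  then obtain n where n: "1 - \<eta> < measure M (U n)" by (auto simp: eventually_sequentially)
  have "measure M (- U n) = 1 - measure M (U n)"
    using prob_compl[of "U n"] fs by (auto simp: Compl_eq_Diff_UNIV U_def)
  then have "measure M (- \<Union>(f ` {..<n})) \<le> \<eta>" using n by (simp add: U_def)
  moreover have "f ` {..<n} \<subseteq> ?C" using f by blast
  ultimately show ?thesis by (intro that[of "f ` {..<n}"]) auto
qed

lemma measure_decomp:
  assumes \<nu>: "regular \<nu>" and F: "finite F" "F \<subseteq> cylinders T \<xi> p" and G: "G \<in> sets M"
  shows "measure \<nu> G = (\<Sum>W\<in>F. measure \<nu> (W \<inter> G)) + measure \<nu> (- \<Union>F \<inter> G)"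
proof -
  interpret \<nu>: finite_measure \<nu> using regularD[OF \<nu>] by simp
  note [simp] = regularD(2,3)[OF \<nu>]
  have s: "W \<in> sets M" if "W \<in> F" for W using that F cylinders_sets by blast
  then have sU: "\<Union>F \<in> sets M" using F by blast
  then have sC: "- \<Union>F \<in> sets M" using sets.compl_sets[OF sU] by (simp add: Compl_eq_Diff_UNIV)
  have "disjoint_family_on (\<lambda>W. W \<inter> G) F"
    using F disjointD[OF disjoint_cylinders[of p]] unfolding disjoint_family_on_def by blast
  then have "measure \<nu> (\<Union>W\<in>F. W \<inter> G) = (\<Sum>W\<in>F. measure \<nu> (W \<inter> G))"
    using F s G by (intro \<nu>.finite_measure_finite_Union) auto
  moreover have "measure \<nu> ((\<Union>W\<in>F. W \<inter> G) \<union> (- \<Union>F \<inter> G))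
      = measure \<nu> (\<Union>W\<in>F. W \<inter> G) + measure \<nu> (- \<Union>F \<inter> G)"
    using s sU G F sC by (intro \<nu>.finite_measure_Union) auto
  moreover have "(\<Union>W\<in>F. W \<inter> G) \<union> (- \<Union>F \<inter> G) = G" by auto
  ultimately show ?thesis by simp
qed

lemma regular_mono:
  assumes "regular \<nu>" "E \<subseteq> F" "F \<in> sets M"
  shows "measure \<nu> E \<le> measure \<nu> F"
  using finite_measure.finite_measure_mono[OF regularD(1)[OF assms(1)] assms(2)]
    assms regularD[OF assms(1)] by simp

lemma distortion_near_1:
  assumes "0 < \<eta>"
  obtains p where "exp (\<kappa> * \<theta> ^ Suc p) \<le> 1 + \<eta>"
proof -
  have "(\<lambda>p. exp (\<kappa> * \<theta> ^ Suc p)) \<longlonglongrightarrow> exp (\<kappa> * 0)"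
    using theta by (intro tendsto_intros LIMSEQ_Suc LIMSEQ_power_zero) auto
  then have "eventually (\<lambda>p. exp (\<kappa> * \<theta> ^ Suc p) < 1 + \<eta>) sequentially"
    using assms by (intro order_tendstoD) auto
  then show ?thesis using that by (auto simp: eventually_sequentially intro: less_imp_le)
qed

text \<open>By regularity, \<open>\<nu>\<close> can be replaced on the cylinders of some rank by a multiple of \<open>\<mu>\<close>. As the
  density is bounded, finitely many cylinders carry almost all of the mass, and mixing applies to these.\<close>

lemma mixing_upper_weak:
  assumes mix: "mixing M T" and B: "B \<in> sets M" and "0 < \<eta>"
  shows "\<forall>\<^sub>F n in sequentially. \<forall>\<nu>. regular \<nu> \<longrightarrow> bounded_density \<nu> \<longrightarrow>
    measure \<nu> ((T ^^ n) -` B) \<le> measure \<nu> UNIV * (measure M B + \<eta>)"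
proof -
  \<comment> \<open>\<open>3 * \<eta>'\<close> pays for the product of the errors from regularity
    and mixing, \<open>K * \<eta>'\<close> for the mass outside the chosen cylinders.\<close>
  define \<eta>' where "\<eta>' = min 1 (\<eta> / (3 + K))"
  have \<eta>': "0 < \<eta>'" "\<eta>' \<le> 1" "\<eta>' * (3 + K) \<le> \<eta>"
    using \<open>0 < \<eta>\<close> K_pos by (simp_all add: \<eta>'_def flip: pos_le_divide_eq)
  obtain p where p: "exp (\<kappa> * \<theta> ^ Suc p) \<le> 1 + \<eta>'" using distortion_near_1[OF \<eta>'(1)] .
  obtain F where F: "finite F" "F \<subseteq> cylinders T \<xi> (Suc p)" "measure M (- \<Union>F) \<le> \<eta>'"
    using finite_cylinder_family[OF \<eta>'(1)] .
  have Fs: "W \<in> sets M" if "W \<in> F" for W using that F cylinders_sets by blast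
  have "\<forall>\<^sub>F n in sequentially. \<forall>W\<in>F. measure M (W \<inter> (T ^^ n) -` B) \<le> measure M W * (measure M B + \<eta>')"
  proof (intro eventually_ball_finite F(1) ballI)
    fix W assume W: "W \<in> F"
    show "\<forall>\<^sub>F n in sequentially. measure M (W \<inter> (T ^^ n) -` B) \<le> measure M W * (measure M B + \<eta>')"
    proof (cases "measure M W = 0")
      case True
      have "measure M (W \<inter> (T ^^ n) -` B) \<le> measure M W" for n
        using Fs[OF W] by (intro finite_measure_mono) auto
      then show ?thesis using True by (intro always_eventually) (simp add: True)
    next
      case False
      then have "0 < measure M W" using zero_less_measure_iff by blast
      have "(\<lambda>n. measure M (W \<inter> (T ^^ n) -` B)) \<longlonglongrightarrow> measure M W * measure M B"
        using mix Fs[OF W] B by (simp add: mixing_def)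
      moreover have "measure M W * measure M B < measure M W * (measure M B + \<eta>')"
        using \<open>0 < measure M W\<close> \<eta>' by (simp add: algebra_simps)
      ultimately show ?thesis
        by (auto dest: order_tendstoD(2) elim!: eventually_mono intro: less_imp_le)
    qed
  qed
  then show ?thesis
  proof eventually_elim
    case (elim n)
    show ?case
    proof (intro allI impI)
      fix \<nu> assume \<nu>: "regular \<nu>" and bd: "bounded_density \<nu>"
      let ?G = "(T ^^ n) -` B" and ?s = "measure \<nu> UNIV"
      have G: "?G \<in> sets M" using B by (rule vimage_funpow_T)
      have sU: "- \<Union>F \<in> sets M" using Fs F(1) by (intro Compl_sets sets.finite_Union) auto
      have cyl: "measure \<nu> (W \<inter> ?G) \<le> (1 + \<eta>') * (measure M B + \<eta>') * measure \<nu> W" if W: "W \<in> F" for W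
      proof (cases "measure M W = 0")
        case True
        then have "measure \<nu> W = 0" using regular_null[OF \<nu> Fs[OF W]] by simp
        then show ?thesis using regular_mono[OF \<nu>, of "W \<inter> ?G" W] Fs[OF W] by simp
      next
        case False
        then have pos: "0 < measure M W" using zero_less_measure_iff by blast
        \<comment> \<open>Regularity is used for \<open>W \<inter> ?G\<close> against
          \<open>W\<close> itself, so it compares the shares of \<open>?G\<close> in
          \<open>W\<close> under the two measures.\<close>
        have "measure \<nu> (W \<inter> ?G) * measure M W \<le> exp (\<kappa> * \<theta> ^ Suc p) * measure \<nu> W * measure M (W \<inter> ?G)"
          using W F(2) Fs[OF W] G by (intro regular_ratio[OF \<nu>]) auto
        also have "\<dots> \<le> (1 + \<eta>') * measure \<nu> W * (measure M W * (measure M B + \<eta>'))"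
          using p elim W \<eta>' by (intro mult_mono) auto
        finally have "measure \<nu> (W \<inter> ?G) * measure M W
            \<le> ((1 + \<eta>') * (measure M B + \<eta>') * measure \<nu> W) * measure M W" by (simp add: algebra_simps)
        then show ?thesis using pos by simp
      qed
      have "(\<Sum>W\<in>F. measure \<nu> (W \<inter> ?G)) \<le> (\<Sum>W\<in>F. (1 + \<eta>') * (measure M B + \<eta>') * measure \<nu> W)"
        by (intro sum_mono cyl)
      also have "\<dots> = (1 + \<eta>') * (measure M B + \<eta>') * (\<Sum>W\<in>F. measure \<nu> W)"
        by (simp add: sum_distrib_left)
      also have "\<dots> \<le> (1 + \<eta>') * (measure M B + \<eta>') * ?s"
        using measure_decomp[OF \<nu> F(1,2) sets.top] \<eta>' by (intro mult_left_mono mult_nonneg_nonneg) auto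
      also have "\<dots> \<le> (measure M B + 3 * \<eta>') * ?s"
      proof (rule mult_right_mono)
        have "\<eta>' * measure M B \<le> \<eta>'" "\<eta>' * \<eta>' \<le> \<eta>'" using \<eta>' by (auto intro: mult_left_le)
        then show "(1 + \<eta>') * (measure M B + \<eta>') \<le> measure M B + 3 * \<eta>'" by (simp add: algebra_simps)
      qed simp
      finally have 1: "(\<Sum>W\<in>F. measure \<nu> (W \<inter> ?G)) \<le> (measure M B + 3 * \<eta>') * ?s" .
      have "measure \<nu> (- \<Union>F \<inter> ?G) \<le> measure \<nu> (- \<Union>F)" by (rule regular_mono[OF \<nu> _ sU]) auto
      also have "\<dots> \<le> K * ?s * measure M (- \<Union>F)" using bounded_densityD[OF bd sU] .
      also have "\<dots> \<le> K * ?s * \<eta>'" using F(3) K_pos by (intro mult_left_mono) auto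
      finally have "measure \<nu> ?G \<le> (measure M B + 3 * \<eta>') * ?s + K * ?s * \<eta>'"
        using measure_decomp[OF \<nu> F(1,2) G] 1 by simp
      also have "\<dots> = ?s * (measure M B + \<eta>' * (3 + K))" by (simp add: algebra_simps)
      also have "\<dots> \<le> ?s * (measure M B + \<eta>)" using \<eta>' by (intro mult_left_mono) auto
      finally show "measure \<nu> ?G \<le> ?s * (measure M B + \<eta>)" .
    qed
  qed
qed

text \<open>The lower bound for \<open>B\<close> is the upper bound for its complement, because the
  total mass is preserved.\<close>

lemma mixing_weak:
  assumes mix: "mixing M T" and B: "B \<in> sets M" and "0 < \<eta>"
  shows "\<forall>\<^sub>F n in sequentially. \<forall>\<nu>. regular \<nu> \<longrightarrow> bounded_density \<nu> \<longrightarrow>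
    \<bar>measure \<nu> ((T ^^ n) -` B) - measure \<nu> UNIV * measure M B\<bar> \<le> measure \<nu> UNIV * \<eta>"
proof -
  have B': "- B \<in> sets M" using sets.compl_sets[OF B] by (simp add: Compl_eq_Diff_UNIV)
  from mixing_upper_weak[OF mix B \<open>0 < \<eta>\<close>] mixing_upper_weak[OF mix B' \<open>0 < \<eta>\<close>]
  show ?thesis
  proof eventually_elim
    case (elim n)
    show ?case
    proof (intro allI impI)
      fix \<nu> assume \<nu>: "regular \<nu>" "bounded_density \<nu>"
      interpret \<nu>: finite_measure \<nu> using regularD[OF \<nu>(1)] by simp
      note [simp] = regularD(2,3)[OF \<nu>(1)]
      have "(T ^^ n) -` (- B) = space \<nu> - (T ^^ n) -` B" by auto
      then have "measure \<nu> ((T ^^ n) -` (- B)) = measure \<nu> UNIV - measure \<nu> ((T ^^ n) -` B)"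
        using \<nu>.finite_measure_compl[of "(T ^^ n) -` B"] B by simp
      moreover have "measure M (- B) = 1 - measure M B"
        using prob_compl[OF B] by (simp add: Compl_eq_Diff_UNIV)
      ultimately have "measure \<nu> UNIV - measure \<nu> ((T ^^ n) -` B) \<le> measure \<nu> UNIV * (1 - measure M B + \<eta>)"
        using elim(2) \<nu> by metis
      moreover have "measure \<nu> ((T ^^ n) -` B) \<le> measure \<nu> UNIV * (measure M B + \<eta>)" using elim(1) \<nu> by blast
      ultimately show "\<bar>measure \<nu> ((T ^^ n) -` B) - measure \<nu> UNIV * measure M B\<bar> \<le> measure \<nu> UNIV * \<eta>"
        by (simp add: algebra_simps abs_le_iff)
    qed
  qed
qed

lemma iterate_push:
  assumes "regular \<nu>"
  shows "regular ((push UNIV ^^ n) \<nu>)"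
    and "E \<in> sets M \<Longrightarrow> measure ((push UNIV ^^ n) \<nu>) E = measure \<nu> ((T ^^ n) -` E)"
proof -
  have *: "regular ((push UNIV ^^ n) \<nu>) \<and>
    (\<forall>E\<in>sets M. measure ((push UNIV ^^ n) \<nu>) E = measure \<nu> ((T ^^ n) -` E))"
  proof (induction n)
    case (Suc n)
    have "measure ((push UNIV ^^ Suc n) \<nu>) E = measure \<nu> ((T ^^ Suc n) -` E)" if E: "E \<in> sets M" for E
    proof -
      have "measure ((push UNIV ^^ Suc n) \<nu>) E = measure \<nu> ((T ^^ n) -` T -` E)"
        using Suc E sets.top[of M] by (simp add: measure_push regularD)
      then show ?thesis by (simp add: vimage_comp)
    qed
    moreover have "regular ((push UNIV ^^ Suc n) \<nu>)"
      using Suc by (simp add: regular_push partition_measurable_UNIV)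
    ultimately show ?case by blast
  qed (simp add: assms)
  then show "regular ((push UNIV ^^ n) \<nu>)"
    and "E \<in> sets M \<Longrightarrow> measure ((push UNIV ^^ n) \<nu>) E = measure \<nu> ((T ^^ n) -` E)" by auto
qed

text \<open>The error is relative to \<open>measure M E\<close>, and \<open>n\<close> does not
  depend on \<open>E\<close>; both matter because \<open>E\<close> will be a subset of a shrinking
  target.\<close>

definition equidistribution_time :: "real \<Rightarrow> nat \<Rightarrow> bool" where
  "equidistribution_time \<epsilon> n \<longleftrightarrow>
    (\<forall>\<nu> E. regular \<nu> \<longrightarrow> bounded_density \<nu> \<longrightarrow> E \<in> sets M \<longrightarrow>
      \<bar>measure \<nu> ((T ^^ n) -` E) - measure \<nu> UNIV * measure M E\<bar> \<le> \<epsilon> * measure \<nu> UNIV * measure M E)"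

text \<open>The weak estimate first equidistributes \<open>\<nu>\<close> over finitely many cylinders of rank \<open>p\<close>. Transporting by
  another \<open>p\<close> steps turns what is left over into a small bounded density.\<close>

lemma mixing_uniform:
  assumes mix: "mixing M T" and "0 < \<epsilon>"
  obtains n where "equidistribution_time \<epsilon> n"
proof -
  \<comment> \<open>The upper estimate loses \<open>(3 + K * K) * \<eta>\<close>, the lower one
    \<open>(2 + K) * \<eta>\<close>; the chosen denominator covers both. The bound
    \<open>1 / 2\<close> keeps \<open>1 - 2 * \<eta>\<close> nonnegative.\<close>
  define \<eta> where "\<eta> = min (1 / 2) (\<epsilon> / (3 + K + K * K))"
  have Kpos: "0 < 3 + K + K * K" using K_pos by (simp add: add_pos_pos)
  have \<eta>: "0 < \<eta>" "\<eta> \<le> 1 / 2" "\<eta> * (3 + K + K * K) \<le> \<epsilon>"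
    unfolding pos_le_divide_eq[OF Kpos, symmetric]
    unfolding \<eta>_def by (simp_all only: min_less_iff_conj divide_pos_pos[OF \<open>0 < \<epsilon>\<close> Kpos]) auto
  obtain p where p: "exp (\<kappa> * \<theta> ^ Suc p) \<le> 1 + \<eta>" using distortion_near_1[OF \<eta>(1)] .
  obtain F where F: "finite F" "F \<subseteq> cylinders T \<xi> (Suc p)" "measure M (- \<Union>F) \<le> \<eta>"
    using finite_cylinder_family[OF \<eta>(1)] .
  have Fs: "W \<in> sets M" if "W \<in> F" for W using that F cylinders_sets by blast
  have sU: "- \<Union>F \<in> sets M" using Fs F(1) by (intro Compl_sets sets.finite_Union) auto
  have "\<forall>\<^sub>F n in sequentially. \<forall>W\<in>F. \<forall>\<nu>. regular \<nu> \<longrightarrow> bounded_density \<nu> \<longrightarrow>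
    \<bar>measure \<nu> ((T ^^ n) -` W) - measure \<nu> UNIV * measure M W\<bar> \<le> measure \<nu> UNIV * (\<eta> * measure M W)"
  proof (intro eventually_ball_finite F(1) ballI)
    fix W assume W: "W \<in> F"
    show "\<forall>\<^sub>F n in sequentially. \<forall>\<nu>. regular \<nu> \<longrightarrow> bounded_density \<nu> \<longrightarrow>
      \<bar>measure \<nu> ((T ^^ n) -` W) - measure \<nu> UNIV * measure M W\<bar> \<le> measure \<nu> UNIV * (\<eta> * measure M W)"
    proof (cases "measure M W = 0")
      case True
      have "measure \<nu> ((T ^^ n) -` W) = 0" if "regular \<nu>" for \<nu> n
        using regular_null[OF that] Fs[OF W] True by (simp add: measure_vimage_funpow_T)
      then show ?thesis using True by (intro always_eventually) simp
    next
      case False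
      \<comment> \<open>An accuracy proportional to the mass of \<open>W\<close> makes the weak
        estimate a relative one on the finitely many cylinders of positive measure.\<close>
      then have "0 < \<eta> * measure M W" using \<eta> by (simp add: zero_less_measure_iff)
      then show ?thesis by (rule mixing_weak[OF mix Fs[OF W]])
    qed
  qed
  then obtain n where n: "\<And>W \<nu>. W \<in> F \<Longrightarrow> regular \<nu> \<Longrightarrow> bounded_density \<nu> \<Longrightarrow>
    \<bar>measure \<nu> ((T ^^ n) -` W) - measure \<nu> UNIV * measure M W\<bar> \<le> measure \<nu> UNIV * (\<eta> * measure M W)"
    unfolding eventually_sequentially by blast
  show ?thesis
  proof (rule that[of "Suc p + n"], unfold equidistribution_time_def, intro allI impI)
    fix \<nu> E assume \<nu>: "regular \<nu>" and bd: "bounded_density \<nu>" and E: "E \<in> sets M"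
    \<comment> \<open>From here on \<open>\<mu>\<close> is the law after \<open>n\<close> steps; the
      invariant measure is \<open>M\<close>.\<close>
    define \<mu> where "\<mu> = (push UNIV ^^ n) \<nu>"
    define G where "G = (T ^^ Suc p) -` E"
    define s where "s = measure \<nu> UNIV"
    have s0: "0 \<le> s" by (simp add: s_def)
    have \<mu>: "regular \<mu>" and m: "\<And>E. E \<in> sets M \<Longrightarrow> measure \<mu> E = measure \<nu> ((T ^^ n) -` E)"
      using iterate_push[OF \<nu>] by (auto simp: \<mu>_def)
    have G: "G \<in> sets M" "measure M G = measure M E"
      unfolding G_def using E by (rule vimage_funpow_T, rule measure_vimage_funpow_T)
    have \<mu>G: "measure \<mu> G = measure \<nu> ((T ^^ (Suc p + n)) -` E)"
      using m[OF G(1)] by (simp only: G_def vimage_comp funpow_add)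
    have bad: "measure M (- \<Union>F \<inter> G) \<le> K * \<eta> * measure M E"
    proof -
      have "measure M (- \<Union>F \<inter> G) \<le> K * measure M (- \<Union>F) * measure M E"
        unfolding G_def
      proof (rule union_of_cylinders_mass_bound[OF regular_self sU E])
        fix W assume "W \<in> cylinders T \<xi> (Suc p)"
        then show "W \<subseteq> - \<Union>F \<or> W \<inter> - \<Union>F = {}"
          using F(2) disjointD[OF disjoint_cylinders[of "Suc p"]] by blast
      qed
      also have "\<dots> \<le> K * \<eta> * measure M E"
        using F(3) K_pos by (intro mult_right_mono mult_left_mono) auto
      finally show ?thesis .
    qed
    \<comment> \<open>One factor \<open>K\<close> bounds the density of \<open>\<nu>\<close>, the
      other the density of the leftover mass after \<open>Suc p\<close> further steps.\<close>
    have bad': "measure \<mu> (- \<Union>F \<inter> G) \<le> K * s * (K * \<eta> * measure M E)"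
    proof -
      have "measure \<mu> (- \<Union>F \<inter> G) \<le> K * s * measure M ((T ^^ n) -` (- \<Union>F \<inter> G))"
        unfolding s_def using sU G(1) by (simp add: m bounded_densityD[OF bd] del: vimage_Int)
      also have "\<dots> = K * s * measure M (- \<Union>F \<inter> G)"
        using sU G(1) by (simp add: measure_vimage_funpow_T del: vimage_Int)
      also have "\<dots> \<le> K * s * (K * \<eta> * measure M E)"
        using bad K_pos s0 by (intro mult_left_mono) auto
      finally show ?thesis .
    qed
    \<comment> \<open>Regularity gives the share of \<open>G\<close> within \<open>W\<close> up to a
      factor \<open>1 + \<eta>\<close>, and the choice of \<open>n\<close> gives the mass of
      \<open>W\<close> up to \<open>1 \<plusminus> \<eta>\<close>.\<close>
    have cyl: "measure \<mu> (W \<inter> G) \<le> (1 + 3 * \<eta>) * s * measure M (W \<inter> G) \<and>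
        (1 - 2 * \<eta>) * s * measure M (W \<inter> G) \<le> measure \<mu> (W \<inter> G)" if W: "W \<in> F" for W
    proof (cases "measure M W = 0")
      case True
      then have "measure M (W \<inter> G) = 0"
        using finite_measure_mono[of "W \<inter> G" W] Fs[OF W] measure_nonneg[of M "W \<inter> G"] by simp
      moreover have "measure \<mu> (W \<inter> G) = 0"
        using regular_null[OF \<mu>] calculation Fs[OF W] G(1) by simp
      ultimately show ?thesis by simp
    next
      case False
      define w where "w = measure M W"
      define g where "g = measure M (W \<inter> G)"
      define x where "x = measure \<mu> (W \<inter> G)"
      define e where "e = exp (\<kappa> * \<theta> ^ Suc p)"
      have w: "0 < w" and g: "0 \<le> g" and x: "0 \<le> x" and e: "0 \<le> e" "e \<le> 1 + \<eta>"
        using False p by (auto simp: w_def g_def x_def e_def zero_less_measure_iff)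
      have W': "W \<in> cylinders T \<xi> (Suc p)" using W F(2) by blast
      have u: "x * w \<le> e * measure \<mu> W * g" and l: "measure \<mu> W * g \<le> e * x * w"
        using regular_ratio[OF \<mu> W', of "W \<inter> G" W] regular_ratio[OF \<mu> W', of W "W \<inter> G"] Fs[OF W] G(1)
        by (auto simp: x_def w_def g_def e_def)
      have d: "\<bar>measure \<mu> W - s * w\<bar> \<le> s * (\<eta> * w)"
        using n[OF W \<nu> bd] by (simp add: m[OF Fs[OF W]] s_def w_def)
      have sq: "\<eta> * \<eta> \<le> \<eta> * 1" using \<eta> by (intro mult_left_mono) auto
      have "x * w \<le> (1 + \<eta>) * measure \<mu> W * g"
        using u e g by (meson measure_nonneg mult_right_mono order_trans)
      also have "\<dots> \<le> (1 + \<eta>) * ((1 + \<eta>) * s * w) * g"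
        using d g \<eta> by (intro mult_right_mono mult_left_mono) (auto simp: algebra_simps)
      also have "\<dots> = ((1 + \<eta>) * (1 + \<eta>)) * (s * w * g)" by simp
      also have "\<dots> \<le> (1 + 3 * \<eta>) * (s * w * g)"
        using sq s0 w g by (intro mult_right_mono) (auto simp: algebra_simps)
      finally have "x * w \<le> ((1 + 3 * \<eta>) * s * g) * w" by (simp add: algebra_simps)
      then have 1: "x \<le> (1 + 3 * \<eta>) * s * g" using w by simp
      have "(1 - \<eta>) * s * w * g \<le> measure \<mu> W * g"
        using d g by (intro mult_right_mono) (auto simp: algebra_simps)
      also have "\<dots> \<le> e * (x * w)" using l by (simp add: algebra_simps)
      also have "\<dots> \<le> (1 + \<eta>) * (x * w)" using e x w by (intro mult_right_mono) auto
      finally have "((1 - \<eta>) * s * g) * w \<le> ((1 + \<eta>) * x) * w" by (simp add: algebra_simps)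
      then have 2: "(1 - \<eta>) * (s * g) \<le> (1 + \<eta>) * x" using w by (simp add: mult.assoc)
      \<comment> \<open>This is \<open>(1 - \<eta>) / (1 + \<eta>) \<ge> 1 - 2 * \<eta>\<close>,
        cleared of the denominator.\<close>
      have "(1 + \<eta>) * ((1 - 2 * \<eta>) * (s * g)) = ((1 + \<eta>) * (1 - 2 * \<eta>)) * (s * g)" by simp
      also have "\<dots> \<le> (1 - \<eta>) * (s * g)"
        using \<eta> s0 g by (intro mult_right_mono) (auto simp: algebra_simps)
      also note 2
      finally have "(1 - 2 * \<eta>) * (s * g) \<le> x" using \<eta> by simp
      then show ?thesis using 1 by (simp add: x_def g_def mult.assoc)
    qed
    have sumM: "(\<Sum>W\<in>F. measure M (W \<inter> G)) = measure M E - measure M (- \<Union>F \<inter> G)"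
      using measure_decomp[OF regular_self F(1,2) G(1)] G(2) by simp
    have "measure \<mu> G = (\<Sum>W\<in>F. measure \<mu> (W \<inter> G)) + measure \<mu> (- \<Union>F \<inter> G)"
      by (rule measure_decomp[OF \<mu> F(1,2) G(1)])
    note dec = this
    have "(\<Sum>W\<in>F. measure \<mu> (W \<inter> G)) \<le> (\<Sum>W\<in>F. (1 + 3 * \<eta>) * s * measure M (W \<inter> G))"
      using cyl by (intro sum_mono) auto
    also have "\<dots> = (1 + 3 * \<eta>) * s * (measure M E - measure M (- \<Union>F \<inter> G))"
      by (simp add: sum_distrib_left[symmetric] sumM)
    also have "\<dots> \<le> (1 + 3 * \<eta>) * s * measure M E" using \<eta> s0 by (intro mult_left_mono) auto
    finally have "measure \<mu> G \<le> (1 + 3 * \<eta>) * s * measure M E + K * s * (K * \<eta> * measure M E)"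
      using dec bad' by linarith
    also have "\<dots> = s * measure M E + (\<eta> * (3 + K * K)) * (s * measure M E)" by (simp add: algebra_simps)
    also have "\<dots> \<le> s * measure M E + \<epsilon> * (s * measure M E)"
    proof (intro add_left_mono mult_right_mono)
      have "\<eta> * (3 + K * K) \<le> \<eta> * (3 + K + K * K)" using \<eta> K_pos by (intro mult_left_mono) auto
      then show "\<eta> * (3 + K * K) \<le> \<epsilon>" using \<eta> by linarith
    qed (use s0 in auto)
    finally have upper: "measure \<mu> G \<le> s * measure M E + \<epsilon> * (s * measure M E)" .
    have "s * measure M E - \<epsilon> * (s * measure M E) \<le> s * measure M E - (\<eta> * (2 + K)) * (s * measure M E)"
    proof (intro diff_left_mono mult_right_mono)
      have "\<eta> * (2 + K) \<le> \<eta> * (3 + K + K * K)" using \<eta> K_pos by (intro mult_left_mono) auto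
      then show "\<eta> * (2 + K) \<le> \<epsilon>" using \<eta> by linarith
    qed (use s0 in auto)
    also have "\<dots> \<le> (1 - 2 * \<eta>) * s * (measure M E - K * \<eta> * measure M E)"
    proof -
      have "0 \<le> 2 * \<eta> * K * \<eta> * (s * measure M E)"
        using \<eta> K_pos s0 by (intro mult_nonneg_nonneg) auto
      then show ?thesis by (simp add: algebra_simps)
    qed
    also have "\<dots> \<le> (1 - 2 * \<eta>) * s * (measure M E - measure M (- \<Union>F \<inter> G))"
      using bad \<eta> s0 by (intro mult_left_mono) auto
    also have "\<dots> = (\<Sum>W\<in>F. (1 - 2 * \<eta>) * s * measure M (W \<inter> G))"
      by (simp add: sum_distrib_left[symmetric] sumM)
    also have "\<dots> \<le> (\<Sum>W\<in>F. measure \<mu> (W \<inter> G))" using cyl by (intro sum_mono) auto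
    also have "\<dots> \<le> measure \<mu> G" using dec by simp
    finally have "s * measure M E - \<epsilon> * (s * measure M E) \<le> measure \<mu> G" .
    with upper show "\<bar>measure \<nu> ((T ^^ (Suc p + n)) -` E) - measure \<nu> UNIV * measure M E\<bar>
        \<le> \<epsilon> * measure \<nu> UNIV * measure M E"
      unfolding \<mu>G[symmetric] s_def by (simp add: abs_le_iff algebra_simps)
  qed
qed


subsection \<open>The first hitting time\<close>

text \<open>The first push is unrestricted: hitting times start at \<open>1\<close>, so the position
  at time \<open>0\<close> is not tested. It also makes the density bounded from the start. Index
  \<open>n\<close> thus belongs to time \<open>n + 1\<close>, at which \<open>A\<close> has not been
  tested yet.\<close>

primrec survive :: "'a set \<Rightarrow> 'a measure \<Rightarrow> nat \<Rightarrow> 'a measure" where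
  "survive A \<nu> 0 = push UNIV \<nu>"
| "survive A \<nu> (Suc n) = push (- A) (survive A \<nu> n)"

lemma regular_survive:
  assumes "regular \<nu>" "partition_measurable M \<xi> A"
  shows "regular (survive A \<nu> n)"
  by (induction n) (use assms in \<open>auto intro: regular_push partition_measurable_UNIV partition_measurable_Compl\<close>)

lemma bounded_density_survive:
  assumes "regular \<nu>" "partition_measurable M \<xi> A"
  shows "bounded_density (survive A \<nu> n)"
  by (cases n) (use assms in \<open>auto intro: bounded_density_push regular_survive
    partition_measurable_UNIV partition_measurable_Compl\<close>)

context
  fixes A :: "'a set" and \<nu> :: "'a measure"
  assumes \<nu>: "regular \<nu>" and A: "partition_measurable M \<xi> A"
begin

abbreviation "h \<equiv> survive A \<nu>"
abbreviation "s n \<equiv> measure (h n) UNIV"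

lemma A_sets: "A \<in> sets M"
  using A by (rule partition_measurable_sets)

lemma survive_split:
  assumes "E \<in> sets M"
  shows "measure (h n) (T -` E) = measure (h (Suc n)) E + measure (h n) (A \<inter> T -` E)"
proof -
  have reg: "regular (h n)" by (rule regular_survive[OF \<nu> A])
  interpret hn: finite_measure "h n" using regularD[OF reg] by simp
  note [simp] = regularD(2,3)[OF reg]
  have "measure (h n) ((- A \<inter> T -` E) \<union> (A \<inter> T -` E))
      = measure (h n) (- A \<inter> T -` E) + measure (h n) (A \<inter> T -` E)"
    using assms A_sets Compl_sets[OF A_sets] by (intro hn.finite_measure_Union) auto
  moreover have "(- A \<inter> T -` E) \<union> (A \<inter> T -` E) = T -` E" by auto
  ultimately show ?thesis
    using assms Compl_sets[OF A_sets] by (simp add: measure_push)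
qed

lemma survive_mass_Suc: "s n = s (Suc n) + measure (h n) A"
  using survive_split[OF sets.top[of M], simplified] by simp

lemma survive_mass_0: "s 0 = measure \<nu> UNIV"
  using measure_push[OF regularD(2)[OF \<nu>] sets.top[of M, simplified] sets.top[of M, simplified]] by simp

lemma survive_hit_le: "measure (h n) A \<le> K * measure M A * s n"
  using bounded_densityD[OF bounded_density_survive[OF \<nu> A] A_sets, of n] by (simp add: algebra_simps)

lemma survive_mass_antimono:
  assumes "m \<le> n"
  shows "s n \<le> s m"
proof (rule lift_Suc_antimono_le[OF _ assms])
  show "s (Suc n) \<le> s n" for n
    using survive_mass_Suc[of n] measure_nonneg[of "h n" A] by linarith
qed

text \<open>Since the mass decreases, each of the \<open>n\<close> steps loses at most
  \<open>K * measure M A * s j\<close>.\<close>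

lemma survive_mass_lower:
  assumes "real n * K * measure M A \<le> 1"
  shows "(1 - real n * K * measure M A) * s j \<le> s (j + n)"
  using assms
proof (induction n)
  case (Suc n)
  let ?x = "K * measure M A"
  have x: "0 \<le> ?x" using K_pos by simp
  have "(1 - real (Suc n) * K * measure M A) * s j = (1 - real n * ?x) * s j - ?x * s j"
    by (simp add: algebra_simps)
  also have "\<dots> \<le> s (j + n) - ?x * s (j + n)"
    using Suc x survive_mass_antimono[of j "j + n"]
    by (intro diff_mono mult_left_mono) (auto simp: algebra_simps)
  also have "\<dots> \<le> s (j + Suc n)"
    using survive_mass_Suc[of "j + n"] survive_hit_le[of "j + n"] by (simp del: survive.simps)
  finally show ?case .
qed simp

text \<open>The part of \<open>h (j + m)\<close> in \<open>A\<close> has mass at most \<open>K \<mu>(A) s j\<close>, and after one more step its density is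
  at most \<open>K\<close> times that mass.\<close>

lemma survive_deficit:
  assumes "E \<in> sets M"
  shows "measure (h (j + i)) E \<le> measure (h j) ((T ^^ i) -` E)"
    and "measure (h j) ((T ^^ i) -` E) \<le> measure (h (j + i)) E + real i * (K * K * measure M A * s j * measure M E)"
proof -
  have "measure (h (j + i)) E \<le> measure (h j) ((T ^^ i) -` E) \<and>
    measure (h j) ((T ^^ i) -` E) \<le> measure (h (j + i)) E + real i * (K * K * measure M A * s j * measure M E)"
    using assms
  proof (induction i arbitrary: E)
    case (Suc i)
    \<comment> \<open>The induction hypothesis is applied to the preimage of \<open>E\<close>, which
      by invariance has the same measure, so the error bound keeps its form.\<close>
    have TE: "T -` E \<in> sets M" using Suc.prems by (rule vimage_T)
    have eq: "(T ^^ i) -` T -` E = (T ^^ Suc i) -` E" by auto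
    note IH = Suc.IH[OF TE, unfolded eq measure_vimage_T[OF Suc.prems]]
    have reg: "regular (h (j + i))" by (rule regular_survive[OF \<nu> A])
    have "measure (h (j + i)) (A \<inter> T -` E) = measure (push A (h (j + i))) E"
      using measure_push[OF regularD(2)[OF reg] A_sets Suc.prems] by simp
    also have "\<dots> \<le> K * measure (h (j + i)) A * measure M E"
      by (rule push_bound[OF reg A Suc.prems])
    also have "\<dots> \<le> K * (K * measure M A * s j) * measure M E"
    proof (intro mult_right_mono mult_left_mono)
      have "K * measure M A * s (j + i) \<le> K * measure M A * s j"
        using survive_mass_antimono[of j "j + i"] K_pos by (intro mult_left_mono) auto
      then show "measure (h (j + i)) A \<le> K * measure M A * s j"
        using survive_hit_le[of "j + i"] by linarith
    qed (use K_pos in auto)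
    finally have hit: "measure (h (j + i)) (A \<inter> T -` E) \<le> K * K * measure M A * s j * measure M E"
      by (simp add: algebra_simps)
    have "measure (h (j + i)) (T -` E) = measure (h (j + Suc i)) E + measure (h (j + i)) (A \<inter> T -` E)"
      using survive_split[OF Suc.prems, of "j + i"] by (simp del: survive.simps)
    moreover have "real (Suc i) * (K * K * measure M A * s j * measure M E)
        = real i * (K * K * measure M A * s j * measure M E) + K * K * measure M A * s j * measure M E"
      by (simp add: algebra_simps)
    ultimately show ?case
      using IH hit measure_nonneg[of "h (j + i)" "A \<inter> T -` E"] by linarith
  qed simp
  then show "measure (h (j + i)) E \<le> measure (h j) ((T ^^ i) -` E)"
    and "measure (h j) ((T ^^ i) -` E) \<le> measure (h (j + i)) E + real i * (K * K * measure M A * s j * measure M E)"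
    by auto
qed

text \<open>\<open>h (m - n)\<close> equidistributes in \<open>n\<close> steps. The first smallness
  condition limits the mass lost meanwhile to the fraction \<open>e / 2\<close>, the second the
  density removed by visits to \<open>A\<close>; so the estimate can be stated relative to
  \<open>s m\<close>.\<close>

lemma survive_equidistributed:
  assumes mix: "equidistribution_time e n"
    and e: "0 < e" "e \<le> 1 / 2"
    and small: "2 * real n * K * measure M A \<le> e" "real n * K * K * measure M A \<le> e"
    and "n \<le> m" and E: "E \<in> sets M"
  shows "(1 - 2 * e) * s m * measure M E \<le> measure (h m) E"
    and "measure (h m) E \<le> (1 + 2 * e) * s m * measure M E"
proof -
  obtain j where m: "m = j + n" using \<open>n \<le> m\<close> by (metis add.commute le_Suc_ex)
  have mx: "\<bar>measure (h j) ((T ^^ n) -` E) - s j * measure M E\<bar> \<le> e * s j * measure M E"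
    using mix E regular_survive[OF \<nu> A] bounded_density_survive[OF \<nu> A]
    by (simp add: equidistribution_time_def)
  have sm: "s m \<le> s j" using survive_mass_antimono m by simp
  have "(1 - 2 * e) * s m * measure M E \<le> (1 - 2 * e) * s j * measure M E"
    using e sm by (intro mult_right_mono mult_left_mono) auto
  also have "\<dots> = (1 - e) * s j * measure M E - e * (s j * measure M E)" by (simp add: algebra_simps)
  also have "\<dots> \<le> (1 - e) * s j * measure M E - (real n * K * K * measure M A) * (s j * measure M E)"
    using small by (intro diff_left_mono mult_right_mono) auto
  also have "\<dots> \<le> measure (h j) ((T ^^ n) -` E) - (real n * K * K * measure M A) * (s j * measure M E)"
    using mx by (auto simp: algebra_simps abs_le_iff)
  also have "\<dots> \<le> measure (h m) E"
    using survive_deficit(2)[OF E, of j n] by (simp add: m algebra_simps)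
  finally show "(1 - 2 * e) * s m * measure M E \<le> measure (h m) E" .
  have "measure (h m) E \<le> (1 + e) * s j * measure M E"
    using survive_deficit(1)[OF E, of j n] mx by (auto simp: m algebra_simps abs_le_iff)
  also have "\<dots> \<le> (1 + 2 * e) * s m * measure M E"
  proof (rule mult_right_mono)
    \<comment> \<open>Amounts to \<open>e * e \<le> e / 2\<close>.\<close>
    have "1 + e \<le> (1 + 2 * e) * (1 - e / 2)"
      using mult_left_mono[OF e(2), of e] e(1) by (simp add: algebra_simps)
    then have "(1 + e) * s j \<le> (1 + 2 * e) * (1 - e / 2) * s j" by (intro mult_right_mono) auto
    also have "\<dots> = (1 + 2 * e) * ((1 - e / 2) * s j)" by simp
    also have "\<dots> \<le> (1 + 2 * e) * ((1 - real n * K * measure M A) * s j)"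
      using small e by (intro mult_left_mono mult_right_mono) auto
    also have "\<dots> \<le> (1 + 2 * e) * s m"
      unfolding m using small e by (intro mult_left_mono survive_mass_lower) auto
    finally show "(1 + e) * s j \<le> (1 + 2 * e) * s m" .
  qed simp
  finally show "measure (h m) E \<le> (1 + 2 * e) * s m * measure M E" .
qed

text \<open>Each step removes a fraction between \<open>(1 - 2 * e) * measure M A\<close> and
  \<open>(1 + 2 * e) * measure M A\<close>. Counting starts at index \<open>n\<close>, because
  equidistribution looks back \<open>n\<close> steps; getting there costs at most the factor
  \<open>1 - e / 2\<close>.\<close>

lemma survive_mass_decay:
  assumes mix: "equidistribution_time e n"
    and e: "0 < e" "e \<le> 1 / 2"
    and small: "2 * real n * K * measure M A \<le> e" "real n * K * K * measure M A \<le> e" "8 * measure M A \<le> e"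
  shows "s (n + i) \<le> measure \<nu> UNIV * exp (- (1 - 2 * e) * measure M A * real i)"
    and "(1 - e / 2) * measure \<nu> UNIV * exp (- (1 + 3 * e) * measure M A * real i) \<le> s (n + i)"
proof -
  let ?a = "measure M A"
  note eq = survive_equidistributed[OF mix e small(1,2)]
  have "s (n + i) \<le> measure \<nu> UNIV * exp (- (1 - 2 * e) * ?a * real i) \<and>
    (1 - e / 2) * measure \<nu> UNIV * exp (- (1 + 3 * e) * ?a * real i) \<le> s (n + i)"
  proof (induction i)
    case 0
    have "(1 - e / 2) * s 0 \<le> (1 - real n * K * ?a) * s 0"
      using small by (intro mult_right_mono) auto
    also have "\<dots> \<le> s n" using survive_mass_lower[of n 0] small e by simp
    finally show ?case using survive_mass_antimono[of 0 n] survive_mass_0 by (simp del: survive.simps)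
  next
    case (Suc i)
    define y z where "y = s (n + i)" and "z = measure (h (n + i)) A"
    have step: "s (n + Suc i) = y - z"
      using survive_mass_Suc[of "n + i"] by (simp add: y_def z_def del: survive.simps)
    have z: "(1 - 2 * e) * y * ?a \<le> z" "z \<le> (1 + 2 * e) * y * ?a"
      unfolding y_def z_def by (intro eq A_sets; simp)+
    have "s (n + Suc i) \<le> s (n + i) * (1 - (1 - 2 * e) * ?a)"
      unfolding step y_def[symmetric] using z(1) by (simp add: algebra_simps)
    also have "\<dots> \<le> s (n + i) * exp (- (1 - 2 * e) * ?a)"
    proof (rule mult_left_mono)
      show "1 - (1 - 2 * e) * ?a \<le> exp (- (1 - 2 * e) * ?a)"
        using exp_ge_add_one_self[of "- (1 - 2 * e) * ?a"] by linarith
    qed simp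
    also have "\<dots> \<le> (measure \<nu> UNIV * exp (- (1 - 2 * e) * ?a * real i)) * exp (- (1 - 2 * e) * ?a)"
      using Suc by (intro mult_right_mono) auto
    also have "\<dots> = measure \<nu> UNIV * exp (- (1 - 2 * e) * ?a * real (Suc i))"
      by (simp add: algebra_simps flip: exp_add)
    finally have upper: "s (n + Suc i) \<le> measure \<nu> UNIV * exp (- (1 - 2 * e) * ?a * real (Suc i))" .
    define x where "x = (1 + 2 * e) * ?a"
    have a: "0 \<le> ?a" "?a \<le> 1 / 16" using small e by auto
    have x: "0 \<le> x" "x \<le> 2 * ?a" using e a by (auto simp: x_def intro!: mult_right_mono)
    \<comment> \<open>By \<open>8 * measure M A \<le> e\<close> the quadratic term of
      \<open>ln (1 - x) \<ge> - x - 2 * x\<^sup>2\<close> is at most \<open>e * measure M A\<close>;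
      it raises the rate from \<open>1 + 2 * e\<close> to \<open>1 + 3 * e\<close>.\<close>
    have "x\<^sup>2 \<le> (2 * ?a)\<^sup>2" using x by (intro power_mono) auto
    also have "\<dots> \<le> ?a * e / 2" using mult_left_mono[OF small(3) a(1)] by (simp add: power2_eq_square)
    finally have "x + 2 * x\<^sup>2 \<le> (1 + 3 * e) * ?a" by (simp add: x_def algebra_simps)
    moreover have "- x - 2 * x\<^sup>2 \<le> ln (1 - x)"
      using x a by (intro ln_one_minus_pos_lower_bound) auto
    ultimately have "- ((1 + 3 * e) * ?a) \<le> ln (1 - x)" by simp
    then have exp_le: "exp (- (1 + 3 * e) * ?a) \<le> 1 - x"
      unfolding minus_mult_left[symmetric] using x a by (simp add: ln_ge_iff)
    have "(1 - e / 2) * measure \<nu> UNIV * exp (- (1 + 3 * e) * ?a * real (Suc i))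
        = ((1 - e / 2) * measure \<nu> UNIV * exp (- (1 + 3 * e) * ?a * real i)) * exp (- (1 + 3 * e) * ?a)"
      by (simp add: algebra_simps flip: exp_add)
    also have "\<dots> \<le> s (n + i) * (1 - x)"
      using Suc exp_le by (intro mult_mono) auto
    also have "\<dots> \<le> s (n + Suc i)"
      unfolding step y_def[symmetric] using z(2) by (simp add: x_def algebra_simps)
    finally show ?case using upper by blast
  qed
  then show "s (n + i) \<le> measure \<nu> UNIV * exp (- (1 - 2 * e) * measure M A * real i)"
    and "(1 - e / 2) * measure \<nu> UNIV * exp (- (1 + 3 * e) * measure M A * real i) \<le> s (n + i)"
    by auto
qed

text \<open>In the exponent the relative error of the rate is multiplied by
  \<open>measure M A * real i\<close>, which is at most \<open>1 / \<delta>\<close>. So the upper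
  bound on the times turns it into a bounded factor.\<close>

lemma survive_asymptotics:
  assumes mix: "equidistribution_time e n"
    and e: "0 < e" "e \<le> 1 / 2"
    and small: "2 * real n * K * measure M A \<le> e" "real n * K * K * measure M A \<le> e" "8 * measure M A \<le> e"
      "(real n + 1) * measure M A \<le> e"
    and \<delta>: "0 < \<delta>" "\<delta> \<le> 1" and k: "measure M A * real k \<le> inverse \<delta>" "n < k"
    and E: "E \<in> sets M"
  shows "measure (h (k - 1)) E \<le> exp (5 * e / \<delta>) * (measure \<nu> UNIV * measure M E * exp (- measure M A * real k))"
    and "(1 - 6 * e / \<delta>) * (measure \<nu> UNIV * measure M E * exp (- measure M A * real k)) \<le> measure (h (k - 1)) E"
proof -
  let ?a = "measure M A" and ?b = "measure \<nu> UNIV * measure M E"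
  obtain i where i: "k = n + i + 1" using \<open>n < k\<close> by (metis less_iff_Suc_add Suc_eq_plus1)
  note eq = survive_equidistributed[OF mix e small(1,2) _ E, of "n + i"]
  note decay = survive_mass_decay[OF mix e small(1,2,3), of i]
  have ak: "?a * real i \<le> ?a * real k" by (simp add: i mult_left_mono)
  have d: "e \<le> e / \<delta>" using e \<delta> by (simp add: field_simps mult_left_le)
  have ek: "e * (?a * real k) \<le> e / \<delta>"
    using mult_left_mono[OF k(1), of e] e by (simp add: field_simps)
  have eki: "e * (?a * real i) \<le> e / \<delta>" using mult_left_mono[OF ak, of e] ek e by linarith
  have "measure (h (k - 1)) E \<le> (1 + 2 * e) * s (n + i) * measure M E" using eq(2)[OF le_add1] by (simp add: i)
  also have "\<dots> \<le> exp (2 * e) * (measure \<nu> UNIV * exp (- (1 - 2 * e) * ?a * real i)) * measure M E"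
    using decay(1) exp_ge_add_one_self[of "2 * e"] e by (intro mult_right_mono mult_mono) auto
  also have "\<dots> = exp (2 * e + (- (1 - 2 * e) * ?a * real i)) * ?b" by (simp add: exp_add)
  also have "\<dots> \<le> exp (5 * e / \<delta> + (- ?a * real k)) * ?b"
  proof (intro mult_right_mono)
    \<comment> \<open>Passing from \<open>i\<close> to \<open>k = n + i + 1\<close> costs
      \<open>(real n + 1) * measure M A\<close>, at most \<open>e\<close>. With \<open>2 * e\<close>
      from equidistribution and \<open>2 * e / \<delta>\<close> from the rate this gives
      \<open>5 * e / \<delta>\<close>.\<close>
    have "- (1 - 2 * e) * ?a * real i = - ?a * real k + (real n + 1) * ?a + 2 * (e * (?a * real i))"
      by (simp add: i algebra_simps)
    then show "exp (2 * e + (- (1 - 2 * e) * ?a * real i)) \<le> exp (5 * e / \<delta> + (- ?a * real k))"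
      using eki small(4) d by simp
  qed simp
  finally show "measure (h (k - 1)) E \<le> exp (5 * e / \<delta>) * (?b * exp (- ?a * real k))"
    by (simp only: exp_add mult_ac)
  \<comment> \<open>The factor \<open>1 - 3 * e / \<delta>\<close> accounts for the rate;
    \<open>1 - 3 * e\<close> lies below \<open>(1 - 2 * e) * (1 - e / 2)\<close>, the losses from
    equidistribution and from the first \<open>n\<close> steps.\<close>
  have "1 - 6 * e / \<delta> \<le> (1 - 3 * e) * (1 - 3 * e / \<delta>)"
  proof -
    have "0 \<le> 9 * e * e / \<delta>" using e \<delta> by simp
    moreover have "(1 - 3 * e) * (1 - 3 * e / \<delta>) = 1 - 3 * e - 3 * (e / \<delta>) + 9 * e * e / \<delta>"
      using \<delta> by (simp add: field_simps)
    ultimately show ?thesis using d by simp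
  qed
  show "(1 - 6 * e / \<delta>) * (?b * exp (- ?a * real k)) \<le> measure (h (k - 1)) E"
  proof (cases "6 * e / \<delta> \<le> 1")
    \<comment> \<open>Here the left-hand side is not positive. In the other case
      \<open>1 - 3 * e / \<delta>\<close> is nonnegative, as multiplying the estimates
      requires.\<close>
    case False
    then have "(1 - 6 * e / \<delta>) * (?b * exp (- ?a * real k)) \<le> 0" by (intro mult_nonpos_nonneg) auto
    then show ?thesis using measure_nonneg order_trans by blast
  next
    case True
    have "(1 - 6 * e / \<delta>) * (?b * exp (- ?a * real k))
        \<le> ((1 - 3 * e) * (1 - 3 * e / \<delta>)) * (?b * exp (- ?a * real k))"
      using \<open>1 - 6 * e / \<delta> \<le> _\<close> by (intro mult_right_mono) auto
    also have "\<dots> = (1 - 3 * e) * ((1 - 3 * e / \<delta>) * exp (- ?a * real k)) * ?b" by simp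
    also have "\<dots> \<le> ((1 - 2 * e) * (1 - e / 2)) * exp (- (1 + 3 * e) * ?a * real i) * ?b"
    proof (intro mult_right_mono mult_mono)
      show "1 - 3 * e \<le> (1 - 2 * e) * (1 - e / 2)" using e by (simp add: algebra_simps)
      have "(1 - 3 * e / \<delta>) * exp (- ?a * real k) \<le> exp (- 3 * e / \<delta>) * exp (- ?a * real k)"
        using exp_ge_add_one_self[of "- 3 * e / \<delta>"] by (intro mult_right_mono) simp_all
      also have "\<dots> = exp (- 3 * e / \<delta> + - ?a * real k)" by (simp only: exp_add)
      also have "\<dots> \<le> exp (- (1 + 3 * e) * ?a * real i)"
      proof -
        have "- (1 + 3 * e) * ?a * real i = - (?a * real i) - 3 * (e * (?a * real i))"
          by (simp add: algebra_simps)
        then show ?thesis using ak eki by simp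
      qed
      finally show "(1 - 3 * e / \<delta>) * exp (- ?a * real k) \<le> exp (- (1 + 3 * e) * ?a * real i)" .
    qed (use e True d in auto)
    also have "\<dots> = (1 - 2 * e) * ((1 - e / 2) * measure \<nu> UNIV * exp (- (1 + 3 * e) * ?a * real i)) * measure M E"
      by simp
    also have "\<dots> \<le> (1 - 2 * e) * s (n + i) * measure M E"
      using decay(2) e by (intro mult_right_mono mult_left_mono) auto
    also have "\<dots> \<le> measure (h (k - 1)) E" using eq(1)[OF le_add1] by (simp add: i)
    finally show ?thesis .
  qed
qed

end

text \<open>The constants are chosen in the order \<open>e\<close>, \<open>n\<close>, then the bound
  on \<open>measure M A\<close>; none of them sees \<open>A\<close>, \<open>\<nu>\<close>,
  \<open>k\<close> or \<open>E\<close>, whence the uniformity.\<close>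

lemma hitting_distribution_asymptotics:
  assumes mix: "mixing M T" and "0 < \<epsilon>" and \<delta>: "0 < \<delta>" "\<delta> \<le> 1"
  obtains a\<^sub>0 where "0 < a\<^sub>0"
    and "\<And>A \<nu> k E. partition_measurable M \<xi> A \<Longrightarrow> measure M A \<le> a\<^sub>0 \<Longrightarrow> regular \<nu> \<Longrightarrow> E \<in> sets M \<Longrightarrow>
      \<delta> \<le> measure M A * real k \<Longrightarrow> measure M A * real k \<le> inverse \<delta> \<Longrightarrow>
      (1 - \<epsilon>) * (measure \<nu> UNIV * measure M E * exp (- measure M A * real k)) \<le> measure (survive A \<nu> (k - 1)) E \<and>
      measure (survive A \<nu> (k - 1)) E \<le> (1 + \<epsilon>) * (measure \<nu> UNIV * measure M E * exp (- measure M A * real k))"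
proof -
  \<comment> \<open>The entry \<open>1 / 4\<close> gives \<open>e < \<delta>\<close> and
    \<open>e \<le> 1 / 2\<close>; the logarithm makes both
    \<open>exp (5 * e / \<delta>) \<le> 1 + \<epsilon>\<close> and
    \<open>6 * e / \<delta> \<le> \<epsilon>\<close> hold.\<close>
  define e where "e = \<delta> * min (1 / 4) (ln (1 + \<epsilon>) / 6)"
  have ln: "0 < ln (1 + \<epsilon>)" "ln (1 + \<epsilon>) \<le> \<epsilon>" using \<open>0 < \<epsilon>\<close> ln_add_one_self_le_self[of \<epsilon>] by auto
  have e: "0 < e" "e \<le> \<delta> * (1 / 4)" "e \<le> \<delta> * (ln (1 + \<epsilon>) / 6)"
    using ln \<delta> unfolding e_def by (auto intro!: mult_left_mono)
  have e2: "e \<le> 1 / 2" "e < \<delta>" using e \<delta> by auto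
  have e6: "6 * e / \<delta> \<le> ln (1 + \<epsilon>)" using e \<delta> by (simp add: field_simps)
  then have "5 * e / \<delta> \<le> ln (1 + \<epsilon>)" using e \<delta> by (simp add: field_simps)
  then have exp5: "exp (5 * e / \<delta>) \<le> 1 + \<epsilon>" using \<open>0 < \<epsilon>\<close> by (simp add: ln_ge_iff)
  obtain n where n: "equidistribution_time e n"
    using mixing_uniform[OF mix e(1)] .
  \<comment> \<open>Dominates the coefficient of \<open>measure M A\<close> in each of the four
    smallness conditions.\<close>
  define N where "N = 8 + (real n + 1) + 2 * real n * K + real n * K * K"
  have Kp: "0 < K" by (rule K_pos)
  have N: "0 < N" using Kp by (simp add: N_def add_pos_nonneg)
  show ?thesis
  proof (rule that[of "e / N"])
    show "0 < e / N" using e N by simp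
    fix A \<nu> k E
    assume A: "partition_measurable M \<xi> A" and a: "measure M A \<le> e / N" and \<nu>: "regular \<nu>" and E: "E \<in> sets M"
      and k: "\<delta> \<le> measure M A * real k" "measure M A * real k \<le> inverse \<delta>"
    let ?a = "measure M A" and ?b = "measure \<nu> UNIV * measure M E * exp (- measure M A * real k)"
    have aN: "?a * N \<le> e" using a N by (simp add: field_simps)
    have small: "c' * ?a \<le> e" if "c' \<le> N" for c'
      using mult_right_mono[OF that, of ?a] aN by (simp add: mult.commute)
    have s1: "2 * real n * K * ?a \<le> e" "real n * K * K * ?a \<le> e" "8 * ?a \<le> e" "(real n + 1) * ?a \<le> e"
      using Kp by (intro small; simp add: N_def)+
    \<comment> \<open>The lower bound on the times enters here: otherwise
      \<open>measure M A * real k\<close> would be at most \<open>e < \<delta>\<close>.\<close>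
    have "n < k"
    proof (rule ccontr)
      assume "\<not> n < k"
      then have "?a * real k \<le> ?a * (real n + 1)" by (intro mult_left_mono) auto
      then show False using k(1) s1(4) e2(2) by (simp add: mult.commute)
    qed
    have b: "0 \<le> ?b" by simp
    note as = survive_asymptotics[OF \<nu> A n e(1) e2(1) s1 \<delta> k(2) \<open>n < k\<close> E]
    have "(1 - \<epsilon>) * ?b \<le> (1 - 6 * e / \<delta>) * ?b" using e6 ln b by (intro mult_right_mono) auto
    moreover have "exp (5 * e / \<delta>) * ?b \<le> (1 + \<epsilon>) * ?b" using exp5 b by (intro mult_right_mono) auto
    ultimately show "(1 - \<epsilon>) * ?b \<le> measure (survive A \<nu> (k - 1)) E \<and>
      measure (survive A \<nu> (k - 1)) E \<le> (1 + \<epsilon>) * ?b"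
      using as by linarith
  qed
qed

end

subsection \<open>Successive visits\<close>

lemma hitting_time_eq_enat_iff:
  "hitting_time T A x = enat k \<longleftrightarrow> 1 \<le> k \<and> (T ^^ k) x \<in> A \<and> (\<forall>i\<in>{1..<k}. (T ^^ i) x \<notin> A)"
proof -
  define S where "S = {enat n |n. n \<ge> 1 \<and> (T ^^ n) x \<in> A}"
  have h: "hitting_time T A x = Inf S" by (simp add: hitting_time_def S_def)
  show ?thesis
  proof
    assume k: "hitting_time T A x = enat k"
    then have "S \<noteq> {}" using h by (auto simp: Inf_enat_def)
    then have "enat k \<in> S" using k h unfolding Inf_enat_def by (metis LeastI_ex ex_in_conv)
    moreover have "(T ^^ i) x \<notin> A" if "i \<in> {1..<k}" for i
    proof
      assume "(T ^^ i) x \<in> A"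
      then have "enat i \<in> S" using that by (auto simp: S_def)
      then have "enat k \<le> enat i" using k h by (metis Inf_lower)
      then show False using that by simp
    qed
    ultimately show "1 \<le> k \<and> (T ^^ k) x \<in> A \<and> (\<forall>i\<in>{1..<k}. (T ^^ i) x \<notin> A)" by (auto simp: S_def)
  next
    assume k: "1 \<le> k \<and> (T ^^ k) x \<in> A \<and> (\<forall>i\<in>{1..<k}. (T ^^ i) x \<notin> A)"
    have "Inf S = enat k"
    proof (rule antisym)
      show "Inf S \<le> enat k" using k by (intro Inf_lower) (auto simp: S_def)
      show "enat k \<le> Inf S"
      proof (rule Inf_greatest)
        fix y assume "y \<in> S"
        then obtain n where "y = enat n" "1 \<le> n" "(T ^^ n) x \<in> A" by (auto simp: S_def)
        then show "enat k \<le> y" using k by (metis atLeastLessThan_iff enat_ord_simps(1) not_le)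
      qed
    qed
    then show "hitting_time T A x = enat k" by (simp add: h)
  qed
qed

lemma first_entrance_hit: "hitting_time T A x = enat k \<Longrightarrow> first_entrance T A x = (T ^^ k) x"
  by (simp add: first_entrance_def)

definition visits :: "('a \<Rightarrow> 'a) \<Rightarrow> 'a set \<Rightarrow> (nat \<Rightarrow> 'a set) \<Rightarrow> (nat \<Rightarrow> nat) \<Rightarrow> nat \<Rightarrow> 'a set" where
  "visits T A C k d = (\<Inter>j<d. (first_entrance T A ^^ j) -`
    ({x. hitting_time T A x = enat (k j)} \<inter> first_entrance T A -` C j))"

text \<open>On the event of the first hit the entrance map is the fixed power
  \<open>T ^^ k 0\<close>; the remaining visits restart at the entrance point with both sequences
  shifted.\<close>

lemma visits_Suc:
  "visits T A C k (Suc d) = {x. hitting_time T A x = enat (k 0) \<and>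
    (T ^^ k 0) x \<in> C 0 \<inter> visits T A (\<lambda>j. C (Suc j)) (\<lambda>j. k (Suc j)) d}"
proof -
  have "visits T A C k (Suc d) = {x. hitting_time T A x = enat (k 0) \<and> first_entrance T A x \<in> C 0 \<and>
    first_entrance T A x \<in> visits T A (\<lambda>j. C (Suc j)) (\<lambda>j. k (Suc j)) d}"
    unfolding visits_def by (simp only: lessThan_Suc_eq_insert_0) (auto simp: funpow_swap1)
  then show ?thesis using first_entrance_hit by force
qed

text \<open>At a finite hitting time the entrance point lies in \<open>A\<close> anyway, so the
  choice \<open>C j = A\<close> imposes no condition.\<close>

lemma visits_eq_hitting:
  "visits T A (\<lambda>j. A) k d = (\<Inter>j<d. (first_entrance T A ^^ j) -` {x. hitting_time T A x = enat (k j)})"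
proof -
  have "{x. hitting_time T A x = enat n} \<inter> first_entrance T A -` A = {x. hitting_time T A x = enat n}" for n
    by (auto simp: first_entrance_hit hitting_time_eq_enat_iff)
  then show ?thesis by (simp add: visits_def)
qed

section \<open>Induction over successive visits\<close>

context bounded_distortion
begin

lemma measure_survive:
  assumes \<nu>: "regular \<nu>" and A: "partition_measurable M \<xi> A" and E: "E \<in> sets M"
  shows "measure (survive A \<nu> n) E = measure \<nu> {x. (\<forall>i\<in>{1..n}. (T ^^ i) x \<notin> A) \<and> (T ^^ Suc n) x \<in> E}"
  using E
proof (induction n arbitrary: E)
  case 0
  then show ?case using measure_push[OF regularD(2)[OF \<nu>], of UNIV E] sets.top[of M] by (simp add: vimage_def)
next
  case (Suc n)
  have A': "- A \<in> sets M" by (rule Compl_sets[OF partition_measurable_sets[OF A]])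
  have "measure (survive A \<nu> (Suc n)) E = measure (survive A \<nu> n) (- A \<inter> T -` E)"
    using measure_push[OF regularD(2)[OF regular_survive[OF \<nu> A]] A' Suc.prems] by simp
  also have "\<dots> = measure \<nu> {x. (\<forall>i\<in>{1..n}. (T ^^ i) x \<notin> A) \<and> (T ^^ Suc n) x \<in> - A \<inter> T -` E}"
    using A' Suc.prems by (intro Suc.IH) auto
  also have "{x. (\<forall>i\<in>{1..n}. (T ^^ i) x \<notin> A) \<and> (T ^^ Suc n) x \<in> - A \<inter> T -` E}
      = {x. (\<forall>i\<in>{1..Suc n}. (T ^^ i) x \<notin> A) \<and> (T ^^ Suc (Suc n)) x \<in> E}"
    unfolding atLeastAtMostSuc_conv[OF le_add1[of 1 n, unfolded plus_1_eq_Suc]] by auto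
  finally show ?case .
qed

lemma hitting_event_sets:
  assumes "A \<in> sets M" "E \<in> sets M"
  shows "{x. hitting_time T A x = enat k \<and> (T ^^ k) x \<in> E} \<in> sets M"
proof -
  have A: "(T ^^ i) -` A \<in> sets M" "(T ^^ i) -` (- A) \<in> sets M" "(T ^^ i) -` E \<in> sets M" for i
    using assms Compl_sets by (auto intro!: vimage_funpow_T)
  \<comment> \<open>Including the index \<open>k\<close> keeps the finite intersection nonempty in
    its index set; for \<open>k = 0\<close> the event itself is empty.\<close>
  have "(\<Inter>i\<in>insert k {1..<k}. (if i = k then (T ^^ k) -` A \<inter> (T ^^ k) -` E else (T ^^ i) -` (- A))) \<in> sets M"
    using A by (intro sets.finite_INT) auto
  moreover have "{x. hitting_time T A x = enat k \<and> (T ^^ k) x \<in> E} =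
    (if 1 \<le> k then (\<Inter>i\<in>insert k {1..<k}. (if i = k then (T ^^ k) -` A \<inter> (T ^^ k) -` E else (T ^^ i) -` (- A))) else {})"
    by (auto simp: hitting_time_eq_enat_iff)
  ultimately show ?thesis by simp
qed

lemma visits_sets:
  assumes "A \<in> sets M" "\<And>j. j < d \<Longrightarrow> C j \<in> sets M"
  shows "visits T A C k d \<in> sets M"
  using assms(2)
proof (induction d arbitrary: C k)
  case 0
  then show ?case using sets.top[of M] by (simp add: visits_def)
next
  case (Suc d)
  then show ?case unfolding visits_Suc by (intro hitting_event_sets assms(1) sets.Int Suc.IH) auto
qed

text \<open>The law at the first visit, restricted to \<open>C 0\<close>, serves as the new initial
  measure. Its index is \<open>k 0 - 1\<close> because \<open>survive\<close> at index
  \<open>n\<close> lives at time \<open>n + 1\<close>.\<close>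

lemma measure_visits_Suc:
  assumes \<nu>: "regular \<nu>" and A: "partition_measurable M \<xi> A"
    and C: "\<And>j. j < Suc d \<Longrightarrow> C j \<in> sets M" "C 0 \<subseteq> A" and k: "1 \<le> k 0"
  shows "measure \<nu> (visits T A C k (Suc d))
    = measure (density (survive A \<nu> (k 0 - 1)) (indicator (C 0)))
        (visits T A (\<lambda>j. C (Suc j)) (\<lambda>j. k (Suc j)) d)"
proof -
  define V where "V = visits T A (\<lambda>j. C (Suc j)) (\<lambda>j. k (Suc j)) d"
  have V: "V \<in> sets M" unfolding V_def by (intro visits_sets partition_measurable_sets A C) auto
  have k': "{1..k 0 - 1} = {1..<k 0}" "Suc (k 0 - 1) = k 0" using k by auto
  have "measure (density (survive A \<nu> (k 0 - 1)) (indicator (C 0))) V = measure (survive A \<nu> (k 0 - 1)) (C 0 \<inter> V)"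
    using regularD(2)[OF regular_survive[OF \<nu> A]] C(1)[of 0] V by (simp add: measure_def emeasure_restricted)
  also have "\<dots> = measure \<nu> {x. (\<forall>i\<in>{1..<k 0}. (T ^^ i) x \<notin> A) \<and> (T ^^ k 0) x \<in> C 0 \<inter> V}"
    using C(1)[of 0] V by (intro measure_survive[OF \<nu> A, of _ "k 0 - 1", unfolded k']) auto
  also have "{x. (\<forall>i\<in>{1..<k 0}. (T ^^ i) x \<notin> A) \<and> (T ^^ k 0) x \<in> C 0 \<inter> V} = visits T A C k (Suc d)"
    unfolding visits_Suc V_def[symmetric] hitting_time_eq_enat_iff using k C(2) by blast
  finally show ?thesis by (simp add: V_def)
qed

text \<open>The bound \<open>hit\<close> is asked for measures of any mass because it is applied to
  the unnormalised law left after each visit. Every visit contributes one factor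
  \<open>1 - \<epsilon>\<close> or \<open>1 + \<epsilon>\<close>.\<close>

lemma visits_estimate:
  assumes A: "partition_measurable M \<xi> A"
    and hit: "\<And>\<nu> k E. regular \<nu> \<Longrightarrow> E \<in> sets M \<Longrightarrow> P k \<Longrightarrow>
      (1 - \<epsilon>) * (measure \<nu> UNIV * measure M E * exp (- measure M A * real k)) \<le> measure (survive A \<nu> (k - 1)) E \<and>
      measure (survive A \<nu> (k - 1)) E \<le> (1 + \<epsilon>) * (measure \<nu> UNIV * measure M E * exp (- measure M A * real k))"
    and P: "\<And>k. P k \<Longrightarrow> 1 \<le> k" and \<epsilon>: "0 \<le> \<epsilon>" "\<epsilon> \<le> 1"
    and "regular \<nu>" and "\<And>j. j < d \<Longrightarrow> P (k j)"
    and "\<And>j. j < d \<Longrightarrow> partition_measurable M \<xi> (C j) \<and> C j \<subseteq> A"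
  shows "(1 - \<epsilon>) ^ d * (measure \<nu> UNIV * (\<Prod>j<d. measure M (C j) * exp (- measure M A * real (k j))))
      \<le> measure \<nu> (visits T A C k d) \<and>
    measure \<nu> (visits T A C k d)
      \<le> (1 + \<epsilon>) ^ d * (measure \<nu> UNIV * (\<Prod>j<d. measure M (C j) * exp (- measure M A * real (k j))))"
  using assms(6-8)
proof (induction d arbitrary: \<nu> C k)
  case 0
  then show ?case by (simp add: visits_def)
next
  case (Suc d)
  define \<mu> where "\<mu> = density (survive A \<nu> (k 0 - 1)) (indicator (C 0))"
  define b where "b = (\<Prod>j<d. measure M (C (Suc j)) * exp (- measure M A * real (k (Suc j))))"
  define q where "q = measure M (C 0) * exp (- measure M A * real (k 0))"
  have b: "0 \<le> b" and q: "0 \<le> q" by (auto simp: b_def q_def intro!: prod_nonneg)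
  have C: "partition_measurable M \<xi> (C j)" "C j \<subseteq> A" if "j < Suc d" for j using Suc.prems(3)[OF that] by auto
  have P0: "P (k 0)" using Suc.prems(2) by simp
  have \<mu>: "regular \<mu>"
    unfolding \<mu>_def by (intro regular_restrict regular_survive A Suc.prems(1) C) simp
  have C0: "C 0 \<in> sets M" by (intro partition_measurable_sets C) simp
  have "measure \<mu> UNIV = measure (survive A \<nu> (k 0 - 1)) (C 0)"
    using regularD(2)[OF regular_survive[OF Suc.prems(1) A]] C0 sets.top[of M]
    by (simp add: \<mu>_def measure_def emeasure_restricted)
  then have mass: "(1 - \<epsilon>) * (measure \<nu> UNIV * q) \<le> measure \<mu> UNIV" "measure \<mu> UNIV \<le> (1 + \<epsilon>) * (measure \<nu> UNIV * q)"
    using hit[OF Suc.prems(1) C0 P0] by (simp_all add: q_def mult.assoc)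
  have IH: "(1 - \<epsilon>) ^ d * (measure \<mu> UNIV * b) \<le> measure \<mu> (visits T A (\<lambda>j. C (Suc j)) (\<lambda>j. k (Suc j)) d) \<and>
    measure \<mu> (visits T A (\<lambda>j. C (Suc j)) (\<lambda>j. k (Suc j)) d) \<le> (1 + \<epsilon>) ^ d * (measure \<mu> UNIV * b)"
    unfolding b_def using Suc.prems by (intro Suc.IH \<mu>) auto
  have eq: "measure \<nu> (visits T A C k (Suc d)) = measure \<mu> (visits T A (\<lambda>j. C (Suc j)) (\<lambda>j. k (Suc j)) d)"
    unfolding \<mu>_def using P[OF P0] C partition_measurable_sets
    by (intro measure_visits_Suc Suc.prems(1) A) auto
  have prod: "(\<Prod>j<Suc d. measure M (C j) * exp (- measure M A * real (k j))) = q * b"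
    by (simp only: prod.lessThan_Suc_shift q_def b_def)
  have "(1 - \<epsilon>) ^ Suc d * (measure \<nu> UNIV * (q * b)) = (1 - \<epsilon>) ^ d * (((1 - \<epsilon>) * (measure \<nu> UNIV * q)) * b)"
    by simp
  also have "\<dots> \<le> (1 - \<epsilon>) ^ d * (measure \<mu> UNIV * b)"
    using mass(1) b \<epsilon> by (intro mult_left_mono mult_right_mono) auto
  finally have lower: "(1 - \<epsilon>) ^ Suc d * (measure \<nu> UNIV * (q * b)) \<le> (1 - \<epsilon>) ^ d * (measure \<mu> UNIV * b)" .
  have "(1 + \<epsilon>) ^ d * (measure \<mu> UNIV * b) \<le> (1 + \<epsilon>) ^ d * (((1 + \<epsilon>) * (measure \<nu> UNIV * q)) * b)"
    using mass(2) b \<epsilon> by (intro mult_left_mono mult_right_mono) auto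
  also have "\<dots> = (1 + \<epsilon>) ^ Suc d * (measure \<nu> UNIV * (q * b))" by simp
  finally show ?case unfolding eq prod using IH lower by linarith
qed

text \<open>The threshold on \<open>measure M (A l)\<close> is independent of the law and the times,
  so one index beyond which it is met serves them all.\<close>

lemma visits_uniform_asymptotics:
  assumes mix: "mixing M T" and A: "\<And>l. partition_measurable M \<xi> (A l)" "\<And>l. 0 < measure M (A l)"
    and lim: "(\<lambda>l. measure M (A l)) \<longlonglongrightarrow> 0" and \<delta>: "0 < \<delta>" "\<delta> \<le> 1"
    and C: "\<And>j l. j < d \<Longrightarrow> partition_measurable M \<xi> (C j l) \<and> 0 < measure M (C j l) \<and> C j l \<subseteq> A l"
    and "0 < \<epsilon>"
  shows "\<exists>l\<^sub>0. \<forall>l\<ge>l\<^sub>0. \<forall>\<nu> k. regular \<nu> \<longrightarrow> measure \<nu> UNIV = 1 \<longrightarrow> k \<in> {..<d} \<rightarrow> admissible_times M A \<delta> \<longrightarrow>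
    \<bar>measure \<nu> (visits T (A l) (\<lambda>j. C j l) (\<lambda>j. k j l) d) /
      (measure M (A l) ^ d * (\<Prod>j<d. measure M (C j l) / measure M (A l))
        * exp (- measure M (A l) * (\<Sum>j<d. real (k j l)))) - 1\<bar> \<le> \<epsilon>"
proof -
  \<comment> \<open>Then \<open>d * \<eta> \<le> ln (1 + \<epsilon>)\<close>, so
    \<open>(1 + \<eta>) ^ d \<le> exp (d * \<eta>)\<close> and Bernoulli's inequality bound the
    error accumulated over \<open>d\<close> visits by \<open>\<epsilon>\<close>.\<close>
  define \<eta> where "\<eta> = min 1 (ln (1 + \<epsilon>) / (1 + real d))"
  have ln: "0 < ln (1 + \<epsilon>)" "ln (1 + \<epsilon>) \<le> \<epsilon>" using \<open>0 < \<epsilon>\<close> ln_add_one_self_le_self[of \<epsilon>] by auto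
  have "\<eta> \<le> ln (1 + \<epsilon>) / (1 + real d)" by (simp add: \<eta>_def)
  then have "\<eta> * (1 + real d) \<le> ln (1 + \<epsilon>)" by (subst (asm) pos_le_divide_eq) auto
  moreover have \<eta>: "0 < \<eta>" "\<eta> \<le> 1" using ln by (auto simp: \<eta>_def intro!: divide_pos_pos)
  ultimately have d\<eta>: "real d * \<eta> \<le> ln (1 + \<epsilon>)" by (simp add: algebra_simps)
  have "(1 + \<eta>) ^ d \<le> exp \<eta> ^ d" using \<eta> by (intro power_mono) auto
  also have "\<dots> = exp (real d * \<eta>)" by (simp add: exp_of_nat_mult)
  also have "\<dots> \<le> 1 + \<epsilon>" using d\<eta> \<open>0 < \<epsilon>\<close> by (simp add: ln_ge_iff)
  finally have up: "(1 + \<eta>) ^ d \<le> 1 + \<epsilon>" .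
  have "1 + real d * (- \<eta>) \<le> (1 + - \<eta>) ^ d" using \<eta> by (intro Bernoulli_inequality) auto
  then have low: "1 - \<epsilon> \<le> (1 - \<eta>) ^ d" using d\<eta> ln by simp
  obtain a\<^sub>0 where a0: "0 < a\<^sub>0" and hit:
    "\<And>A \<nu> k E. partition_measurable M \<xi> A \<Longrightarrow> measure M A \<le> a\<^sub>0 \<Longrightarrow> regular \<nu> \<Longrightarrow> E \<in> sets M \<Longrightarrow>
      \<delta> \<le> measure M A * real k \<Longrightarrow> measure M A * real k \<le> inverse \<delta> \<Longrightarrow>
      (1 - \<eta>) * (measure \<nu> UNIV * measure M E * exp (- measure M A * real k)) \<le> measure (survive A \<nu> (k - 1)) E \<and>
      measure (survive A \<nu> (k - 1)) E \<le> (1 + \<eta>) * (measure \<nu> UNIV * measure M E * exp (- measure M A * real k))"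
    using hitting_distribution_asymptotics[OF mix \<eta>(1) \<delta>] by metis
  from order_tendstoD(2)[OF lim a0] obtain l\<^sub>0 where l0: "\<And>l. l \<ge> l\<^sub>0 \<Longrightarrow> measure M (A l) \<le> a\<^sub>0"
    by (auto simp: eventually_sequentially intro: less_imp_le)
  show ?thesis
  proof (intro exI[of _ l\<^sub>0] allI impI)
    fix l \<nu> k assume l: "l \<ge> l\<^sub>0" and \<nu>: "regular \<nu>" "measure \<nu> UNIV = 1"
      and k: "k \<in> {..<d} \<rightarrow> admissible_times M A \<delta>"
    let ?a = "measure M (A l)" and ?v = "measure \<nu> (visits T (A l) (\<lambda>j. C j l) (\<lambda>j. k j l) d)"
    define b where "b = (\<Prod>j<d. measure M (C j l) * exp (- ?a * real (k j l)))"
    have b: "0 < b" unfolding b_def using C by (intro prod_pos) auto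
    have "b = (\<Prod>j<d. measure M (C j l)) * exp (- ?a * (\<Sum>j<d. real (k j l)))"
      by (simp add: b_def prod.distrib exp_sum sum_distrib_left)
    also have "(\<Prod>j<d. measure M (C j l)) = ?a ^ d * (\<Prod>j<d. measure M (C j l) / ?a)"
      using A(2)[of l] by (simp add: prod_dividef)
    finally have b_eq: "?a ^ d * (\<Prod>j<d. measure M (C j l) / ?a) * exp (- ?a * (\<Sum>j<d. real (k j l))) = b"
      by simp
    have "(1 - \<eta>) ^ d * (measure \<nu> UNIV * b) \<le> ?v \<and> ?v \<le> (1 + \<eta>) ^ d * (measure \<nu> UNIV * b)"
      unfolding b_def
    proof (rule visits_estimate[OF A(1), where P = "\<lambda>n. \<delta> \<le> ?a * real n \<and> ?a * real n \<le> inverse \<delta>"])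
      show "1 \<le> n" if "\<delta> \<le> ?a * real n \<and> ?a * real n \<le> inverse \<delta>" for n
        using that \<delta> by (cases n) auto
      show "\<delta> \<le> ?a * real (k j l) \<and> ?a * real (k j l) \<le> inverse \<delta>" if "j < d" for j
        using k that by (auto simp: admissible_times_def Pi_def)
    qed (use hit[OF A(1) l0[OF l]] \<eta> \<nu> C in auto)
    then have v: "(1 - \<eta>) ^ d * b \<le> ?v" "?v \<le> (1 + \<eta>) ^ d * b" using \<nu> by auto
    have "(1 - \<epsilon>) * b \<le> ?v" using v(1) mult_right_mono[OF low, of b] b by linarith
    moreover have "?v \<le> (1 + \<epsilon>) * b" using v(2) mult_right_mono[OF up, of b] b by linarith
    ultimately show "\<bar>?v / (?a ^ d * (\<Prod>j<d. measure M (C j l) / ?a)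
        * exp (- ?a * (\<Sum>j<d. real (k j l)))) - 1\<bar> \<le> \<epsilon>"
      unfolding b_eq using b by (simp add: abs_le_iff field_simps)
  qed
qed

section \<open>Regularity of the conditioned laws\<close>

lemma regular_density:
  assumes w: "w \<in> prob_densities M" "reg T \<xi> w \<le> ereal r" and r: "0 < r" "r * \<Delta> \<le> \<kappa>" and "0 \<le> q"
  shows "regular (density M (\<lambda>x. ennreal (q * w x)))"
proof -
  have wm [measurable]: "w \<in> borel_measurable M" and w0: "\<And>x. 0 \<le> w x"
    and w1: "(\<integral>\<^sup>+x. ennreal (w x) \<partial>M) = 1"
    using w by (auto simp: prob_densities_def)
  let ?f = "\<lambda>x. ennreal (q * w x)"
  have em: "emeasure (density M ?f) E = (\<integral>\<^sup>+x\<in>E. ?f x \<partial>M)" if "E \<in> sets M" for E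
    using that by (simp add: emeasure_density)
  have total: "(\<integral>\<^sup>+x. ?f x \<partial>M) = ennreal q"
    using \<open>0 \<le> q\<close> w0 w1 by (simp add: ennreal_mult nn_integral_cmult)
  have fin: "finite_measure (density M ?f)"
    by (rule finite_measureI) (use em[OF sets.top] total in simp)
  show ?thesis
    unfolding regular_def
  proof (intro conjI allI impI fin)
    show "absolutely_continuous M (density M ?f)" by (intro absolutely_continuousI_density) simp
    fix p Y E F
    assume Y: "Y \<in> cylinders T \<xi> (Suc p) \<and> E \<in> sets M \<and> F \<in> sets M \<and> E \<subseteq> Y \<and> F \<subseteq> Y"
    then obtain Z where Z: "Z \<in> \<xi>" "Y \<subseteq> Z" using cylinders_subset by blast
    define D where "D = \<Delta> * \<theta> ^ Suc p"
    have D: "0 \<le> D" using Delta_nonneg theta by (simp add: D_def)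
    have "(\<integral>\<^sup>+x\<in>E. ?f x \<partial>M) * emeasure M F \<le> ennreal (1 + r * D) * (\<integral>\<^sup>+x\<in>F. ?f x \<partial>M) * emeasure M E"
    proof (rule nn_integral_ratio_bound)
      \<comment> \<open>Almost all points of \<open>Y\<close> lie in one element of \<beta>, where
        the bound on \<open>reg\<close> applies; their distance is at most \<open>D\<close>.\<close>
      show "AE x in M. AE y in M. x \<in> E \<longrightarrow> y \<in> F \<longrightarrow> ?f x \<le> ennreal (1 + r * D) * ?f y"
        using AE_image_membership[OF Z(1)]
      proof eventually_elim
        case x: (elim x)
        show ?case using AE_image_membership[OF Z(1)]
        proof eventually_elim
          case y: (elim y)
          show ?case
          proof (intro impI)
            assume "x \<in> E" "y \<in> F"
            then have Yxy: "x \<in> Y" "y \<in> Y" using Y by auto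
            let ?R = "{(x, y). \<forall>Z\<in>\<xi>. x \<in> T ` Z \<longleftrightarrow> y \<in> T ` Z}"
            have "\<forall>Z'\<in>\<xi>. x \<in> T ` Z' \<longleftrightarrow> y \<in> T ` Z'"
              using x[rule_format, OF subsetD[OF Z(2) Yxy(1)]] y[rule_format, OF subsetD[OF Z(2) Yxy(2)]]
              by (simp del: image_iff)
            then have B: "x \<in> ?R `` {x}" "y \<in> ?R `` {x}"
              by (simp_all only: Image_singleton_iff mem_Collect_eq prod.case) simp
            have B': "?R `` {x} \<in> image_partition T \<xi>"
              unfolding image_partition_def by (rule quotientI) simp
            have "reg_on (?R `` {x}) w \<le> ereal r"
              using w(2) B' unfolding reg_def by (meson SUP_upper order_trans)
            then have "w x \<le> (1 + r * dist x y) * w y" by (rule reg_on_bound) (use B w0 in auto)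
            also have "\<dots> \<le> (1 + r * D) * w y"
              using cylinder_dist[of Y "Suc p" x y] Y Yxy r w0
              by (intro mult_right_mono add_left_mono mult_left_mono) (auto simp: D_def)
            finally have "q * w x \<le> (1 + r * D) * (q * w y)"
              using mult_left_mono[OF _ \<open>0 \<le> q\<close>, of "w x" "(1 + r * D) * w y"] by (simp add: algebra_simps)
            then show "?f x \<le> ennreal (1 + r * D) * ?f y"
              using r D w0[of y] \<open>0 \<le> q\<close>
              by (subst ennreal_mult[symmetric]) (auto intro: ennreal_leI)
          qed
        qed
      qed
    qed (use Y in auto)
    then have "measure (density M ?f) E * measure M F \<le> (1 + r * D) * measure (density M ?f) F * measure M E"
      using Y r D
      by (intro ennreal_products_le)
        (auto simp: em finite_measure.emeasure_eq_measure[OF fin, symmetric] emeasure_eq_measure[symmetric])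
    also have "\<dots> \<le> exp (\<kappa> * \<theta> ^ Suc p) * measure (density M ?f) F * measure M E"
    proof (intro mult_right_mono)
      have "1 + r * D \<le> exp (r * D)" by (rule exp_ge_add_one_self)
      also have "r * D \<le> \<kappa> * \<theta> ^ Suc p"
        using mult_right_mono[OF r(2), of "\<theta> ^ Suc p"] theta by (simp add: D_def mult.assoc)
      finally show "1 + r * D \<le> exp (\<kappa> * \<theta> ^ Suc p)" by simp
    qed auto
    finally show "measure (density M ?f) E * measure M F
        \<le> exp (\<kappa> * \<theta> ^ Suc p) * measure (density M ?f) F * measure M E" .
  qed simp
qed

text \<open>After \<open>u\<close> is replaced by its regular version \<open>w\<close>, the law is
  the restriction to \<open>C\<close> of a regular measure; the normalising constant is the scaling
  factor \<open>q\<close> of \<open>regular_density\<close>.\<close>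

lemma conditioned_laws_regular:
  assumes r: "0 < r" "r * \<Delta> \<le> \<kappa>" and "\<nu> \<in> conditioned_laws M T \<xi> r A"
  shows "regular \<nu>" and "measure \<nu> UNIV = 1"
proof -
  from assms(3) obtain u C where
    \<nu>: "\<nu> = density M (\<lambda>x. ennreal (inverse (LINT y:C|M. u y) * indicator C x * u x))"
    and u: "u \<in> regular_densities M T \<xi> r" and C: "partition_measurable M \<xi> C"
    and pos: "(LINT y:C|M. u y) > 0"
    by (auto simp: conditioned_laws_def)
  define I where "I = (LINT y:C|M. u y)"
  from u obtain w where w: "w \<in> prob_densities M" "AE x in M. u x = w x" "reg T \<xi> w \<le> ereal r"
    and u': "u \<in> prob_densities M" by (auto simp: regular_densities_def)
  have [measurable]: "C \<in> sets M" "w \<in> borel_measurable M" "u \<in> borel_measurable M" and u0: "\<And>x. 0 \<le> u x"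
    using C w u' by (auto simp: partition_measurable_def prob_densities_def)
  have "0 < I" using pos by (simp add: I_def)
  have "density (density M (\<lambda>x. ennreal (inverse I * w x))) (indicator C)
      = density M (\<lambda>x. ennreal (inverse I * w x) * indicator C x)"
    by (rule density_density_eq) auto
  also have "\<dots> = \<nu>"
    unfolding \<nu> I_def[symmetric]
    by (rule density_cong) (use w(2) in \<open>auto elim!: eventually_mono split: split_indicator\<close>)
  finally have eq: "\<nu> = density (density M (\<lambda>x. ennreal (inverse I * w x))) (indicator C)" ..
  show "regular \<nu>"
    unfolding eq using \<open>0 < I\<close> by (intro regular_restrict C regular_density[OF w(1,3) r]) auto
  have I: "(\<integral>x. indicator C x * u x \<partial>M) = I" by (simp add: I_def set_lebesgue_integral_def)
  \<comment> \<open>The integral of a non-integrable function is \<open>0\<close> by default, so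
    \<open>0 < I\<close> yields integrability.\<close>
  then have int: "integrable M (\<lambda>x. indicator C x * u x)"
    using \<open>0 < I\<close> not_integrable_integral_eq by fastforce
  have "emeasure \<nu> UNIV = (\<integral>\<^sup>+x. ennreal (inverse I * (indicator C x * u x)) \<partial>M)"
    unfolding \<nu> I_def[symmetric] by (subst emeasure_density) (auto simp: mult.assoc space_UNIV[symmetric] simp del: space_UNIV)
  also have "\<dots> = ennreal (\<integral>x. inverse I * (indicator C x * u x) \<partial>M)"
    using int u0 \<open>0 < I\<close> by (intro nn_integral_eq_integral) auto
  also have "\<dots> = 1" using I \<open>0 < I\<close> by simp
  finally show "measure \<nu> UNIV = 1" by (simp add: measure_def)
qed

end

subsection \<open>Bounded distortion of Gibbs-Markov systems\<close>

context gibbs_markov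
begin

lemma inverse_branch_image:
  assumes "Z \<in> \<xi>" "B \<subseteq> T ` Z"
  shows "inverse_branch T Z ` B = Z \<inter> T -` B"
proof -
  have inv: "inverse_branch T Z (T x) = x" if "x \<in> Z" for x
    using homeomorphism_apply1[OF T_homeomorphism[OF assms(1)] that] .
  show ?thesis
  proof (intro subset_antisym subsetI)
    fix y assume "y \<in> inverse_branch T Z ` B"
    then obtain b where b: "b \<in> B" "y = inverse_branch T Z b" by blast
    then obtain x where "x \<in> Z" "b = T x" using assms by auto
    then show "y \<in> Z \<inter> T -` B" using inv b by auto
  next
    fix x assume "x \<in> Z \<inter> T -` B"
    then show "x \<in> inverse_branch T Z ` B" using inv by (metis IntD1 IntD2 imageI vimageD)
  qed
qed

lemma branch_derivative_distortion:
  assumes Z: "Z \<in> \<xi>" and v: "branch_derivative M T Z v"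
    and dist: "\<And>x y. x \<in> T ` Z \<Longrightarrow> y \<in> T ` Z \<Longrightarrow> \<bar>v x / v y - 1\<bar> \<le> L * dist x y"
    and "0 < L" and sets: "E \<in> sets M" "F \<in> sets M" and sub: "E \<subseteq> T ` Z" "F \<subseteq> T ` Z"
    and D: "\<And>x y. x \<in> E \<Longrightarrow> y \<in> F \<Longrightarrow> dist x y \<le> D" "0 \<le> D"
  shows "measure M (Z \<inter> T -` E) * measure M F \<le> (1 + L * D) * measure M (Z \<inter> T -` F) * measure M E"
proof -
  have TZ: "T ` Z \<in> sets M" by (rule image_measurable[OF Z])
  \<comment> \<open>Extension by zero, since \<open>v\<close> is measurable only on the image of
    \<open>Z\<close>.\<close>
  define f where "f x = ennreal (v x) * indicator (T ` Z) x" for x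
  have "(\<lambda>x. ennreal (v x)) \<in> borel_measurable (restrict_space M (T ` Z))"
    using v by (auto simp: branch_derivative_def)
  then have f: "f \<in> borel_measurable M"
    unfolding f_def using TZ by (subst (asm) borel_measurable_restrict_space_iff_ennreal) auto
  have em: "emeasure M (Z \<inter> T -` B) = (\<integral>\<^sup>+x\<in>B. f x \<partial>M)" if "B \<in> sets M" "B \<subseteq> T ` Z" for B
  proof -
    have "emeasure M (Z \<inter> T -` B) = (\<integral>\<^sup>+x\<in>B. ennreal (v x) \<partial>M)"
      using v that inverse_branch_image[OF Z that(2)] by (auto simp: branch_derivative_def)
    also have "\<dots> = (\<integral>\<^sup>+x\<in>B. f x \<partial>M)"
      using that by (intro nn_integral_cong) (auto simp: f_def split: split_indicator)
    finally show ?thesis .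
  qed
  have "(\<integral>\<^sup>+x\<in>E. f x \<partial>M) * emeasure M F \<le> ennreal (1 + L * D) * (\<integral>\<^sup>+x\<in>F. f x \<partial>M) * emeasure M E"
  proof (rule nn_integral_ratio_bound[OF f sets], intro AE_I2 impI)
    fix x y assume xy: "x \<in> E" "y \<in> F"
    then have TZxy: "x \<in> T ` Z" "y \<in> T ` Z" using sub by auto
    \<comment> \<open>If \<open>v y\<close> were \<open>0\<close>, then \<open>v y / v y\<close>
      would be \<open>0\<close> and the bound at distance \<open>0\<close> would read
      \<open>1 \<le> 0\<close>.\<close>
    have "v y \<noteq> 0" using dist[OF TZxy(2) TZxy(2)] by auto
    moreover have "0 \<le> v y" using v TZxy by (auto simp: branch_derivative_def)
    ultimately have "0 < v y" by simp
    have "L * dist x y \<le> L * D" using D xy \<open>0 < L\<close> by (intro mult_left_mono) auto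
    then have "v x / v y \<le> 1 + L * D" using dist[OF TZxy] by linarith
    then have "v x \<le> (1 + L * D) * v y" using \<open>0 < v y\<close> by (simp add: pos_divide_le_eq)
    then have "ennreal (v x) \<le> ennreal (1 + L * D) * ennreal (v y)"
      using D \<open>0 < L\<close> \<open>0 < v y\<close> by (subst ennreal_mult[symmetric]) (auto intro: ennreal_leI)
    then show "f x \<le> ennreal (1 + L * D) * f y"
      using TZxy by (simp add: f_def del: ennreal_plus)
  qed
  then show ?thesis
    using D \<open>0 < L\<close> sets sub
    by (intro ennreal_products_le) (auto simp: em emeasure_eq_measure[symmetric])
qed

lemma bounded_distortion_exists:
  assumes "0 < r"
  obtains \<theta> \<Delta> L c \<kappa> where "bounded_distortion M T \<xi> \<theta> \<Delta> L c \<kappa>" "r * \<Delta> \<le> \<kappa>"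
proof -
  obtain D where D: "\<And>x y :: 'a. dist x y \<le> D"
    using bounded_space unfolding bounded_two_points by auto
  have "0 \<le> D" using D[of undefined undefined] by simp
  obtain N \<rho> where N: "N \<ge> 1" and \<rho>: "0 < \<rho>" "\<rho> < 1"
    and exp: "\<And>Z x y. Z \<in> cylinders T \<xi> N \<Longrightarrow> x \<in> Z \<Longrightarrow> y \<in> Z
      \<Longrightarrow> dist x y \<le> \<rho> * dist ((T ^^ N) x) ((T ^^ N) y)"
    using iterate_expanding unfolding uniformly_expanding_def by blast
  \<comment> \<open>The root spreads the contraction of the \<open>N\<close>-th iterate evenly over
    its \<open>N\<close> steps.\<close>
  define \<theta> where "\<theta> = root N \<rho>"
  have \<theta>: "0 < \<theta>" "\<theta> < 1" "\<theta> ^ N = \<rho>"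
    using N \<rho> by (auto simp: \<theta>_def real_root_gt_zero real_root_pow_pos)
  obtain L v where L: "0 < L" and v: "\<And>Z. Z \<in> \<xi> \<Longrightarrow> branch_derivative M T Z (v Z)"
    and dist: "\<And>Z x y. Z \<in> \<xi> \<Longrightarrow> x \<in> T ` Z \<Longrightarrow> y \<in> T ` Z \<Longrightarrow> \<bar>v Z x / v Z y - 1\<bar> \<le> L * dist x y"
    using distortion by metis
  define \<Delta> where "\<Delta> = D / \<theta> ^ N"
  \<comment> \<open>Chosen so that
    \<open>(1 - \<theta>) * \<kappa> = r * \<Delta> + L * \<Delta>\<close>. The second summand gives
    invariance under transport, the first makes densities with regularity bound \<open>r\<close>
    admissible.\<close>
  define \<kappa> where "\<kappa> = (r * \<Delta> + L * \<Delta>) / (1 - \<theta>)"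
  have \<Delta>: "0 \<le> \<Delta>" using \<open>0 \<le> D\<close> \<theta>(1) by (simp add: \<Delta>_def)
  have k: "(1 - \<theta>) * \<kappa> = r * \<Delta> + L * \<Delta>" using \<theta> by (simp add: \<kappa>_def)
  have k0: "0 \<le> \<kappa>" using \<theta> \<Delta> L assms by (simp add: \<kappa>_def)
  show ?thesis
  proof (rule that)
    show "bounded_distortion M T \<xi> \<theta> \<Delta> L (INF Z\<in>\<xi>. measure M (T ` Z)) \<kappa>"
    proof (unfold_locales, goal_cases)
      case (6 p Y x y)
      show ?case unfolding \<Delta>_def
        by (rule cylinders_dist_bound[OF D \<theta>(1,2) N _ 6]) (use exp \<theta>(3) in auto)
    next
      case (7 Z)
      show ?case by (rule cINF_lower[OF _ 7]) (auto intro!: bdd_belowI2[of _ 0])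
    next
      case (8 Z E F D)
      show ?case by (rule branch_derivative_distortion[OF 8(1) v[OF 8(1)] dist[OF 8(1)] L 8(2-7)])
    qed (use \<theta> L big_images k assms \<Delta> in auto)
    have "\<theta> * \<kappa> \<ge> 0" "L * \<Delta> \<ge> 0" using \<theta> k0 L \<Delta> by auto
    then show "r * \<Delta> \<le> \<kappa>" using k by (simp add: algebra_simps)
  qed
qed

end

section \<open>Uniform asymptotics for one law and for sequences of laws\<close>

theorem theorem3p2:
  fixes M :: "'a :: metric_space measure" and T :: "'a \<Rightarrow> 'a" and \<xi> :: "'a set set"
    and A :: "nat \<Rightarrow> 'a set" and r :: real
  assumes "gibbs_markov M T \<xi>" and "mixing M T"
    and "\<And>l. A l \<in> sets M"
    and "\<And>l. 0 < measure M (A l)"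
    and "(\<lambda>l. measure M (A l)) \<longlonglongrightarrow> 0"
    and "\<And>l. partition_measurable M \<xi> (A l)"
    and "0 < r"
  shows
    "(\<forall>d\<ge>1. \<forall>\<delta>. 0 < \<delta> \<and> \<delta> \<le> 1 \<longrightarrow>
        uniformly_asymp
          (conditioned_laws M T \<xi> r UNIV \<times> ({..<d} \<rightarrow> admissible_times M A \<delta>))
          (\<lambda>(\<nu>, k) l. measure \<nu>
            (\<Inter>j<d. (first_entrance T (A l) ^^ j) -` {x. hitting_time T (A l) x = enat (k j l)}))
          (\<lambda>(\<nu>, k) l. measure M (A l) ^ d * exp (- measure M (A l) * (\<Sum>j<d. real (k j l))))
      \<and> uniformly_asymp
          ((\<Pi> l\<in>UNIV. conditioned_laws M T \<xi> r (A l)) \<times> ({..<d} \<rightarrow> admissible_times M A \<delta>))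
          (\<lambda>(\<nu>, k) l. measure (\<nu> l)
            (\<Inter>j<d. (first_entrance T (A l) ^^ j) -` {x. hitting_time T (A l) x = enat (k j l)}))
          (\<lambda>(\<nu>, k) l. measure M (A l) ^ d * exp (- measure M (A l) * (\<Sum>j<d. real (k j l)))))
    \<and>
     ((\<lambda>l. diameter (A l)) \<longlonglongrightarrow> 0 \<longrightarrow>
      (\<exists>A'. \<forall>l. A' l \<in> image_partition T \<xi> \<and> A l \<subseteq> A' l) \<longrightarrow>
      (\<forall>d\<ge>1. \<forall>C :: nat \<Rightarrow> nat \<Rightarrow> 'a set.
        (\<forall>j<d. \<forall>l. partition_measurable M \<xi> (C j l) \<and> 0 < measure M (C j l) \<and> C j l \<subseteq> A l) \<longrightarrow>
        (\<forall>\<delta>. 0 < \<delta> \<and> \<delta> \<le> 1 \<longrightarrow>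
          uniformly_asymp
            (conditioned_laws M T \<xi> r UNIV \<times> ({..<d} \<rightarrow> admissible_times M A \<delta>))
            (\<lambda>(\<nu>, k) l. measure \<nu>
              (\<Inter>j<d. (first_entrance T (A l) ^^ j) -`
                ({x. hitting_time T (A l) x = enat (k j l)} \<inter> first_entrance T (A l) -` C j l)))
            (\<lambda>(\<nu>, k) l. measure M (A l) ^ d * (\<Prod>j<d. measure M (C j l) / measure M (A l))
              * exp (- measure M (A l) * (\<Sum>j<d. real (k j l))))
        \<and> uniformly_asymp
            ((\<Pi> l\<in>UNIV. conditioned_laws M T \<xi> r (A l)) \<times> ({..<d} \<rightarrow> admissible_times M A \<delta>))
            (\<lambda>(\<nu>, k) l. measure (\<nu> l)
              (\<Inter>j<d. (first_entrance T (A l) ^^ j) -`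
                ({x. hitting_time T (A l) x = enat (k j l)} \<inter> first_entrance T (A l) -` C j l)))
            (\<lambda>(\<nu>, k) l. measure M (A l) ^ d * (\<Prod>j<d. measure M (C j l) / measure M (A l))
              * exp (- measure M (A l) * (\<Sum>j<d. real (k j l)))))))"
proof -
  interpret gibbs_markov M T \<xi> by (rule assms(1))
  obtain \<theta> \<Delta> L c \<kappa> where bd: "bounded_distortion M T \<xi> \<theta> \<Delta> L c \<kappa>" and r: "r * \<Delta> \<le> \<kappa>"
    using bounded_distortion_exists[OF \<open>0 < r\<close>] .
  interpret bounded_distortion M T \<xi> \<theta> \<Delta> L c \<kappa> by (rule bd)
  have *: "uniformly_asymp (conditioned_laws M T \<xi> r UNIV \<times> ({..<d} \<rightarrow> admissible_times M A \<delta>))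
          (\<lambda>(\<nu>, k) l. measure \<nu> (visits T (A l) (\<lambda>j. C j l) (\<lambda>j. k j l) d))
          (\<lambda>(\<nu>, k) l. measure M (A l) ^ d * (\<Prod>j<d. measure M (C j l) / measure M (A l))
              * exp (- measure M (A l) * (\<Sum>j<d. real (k j l))))" (is ?V)
    and **: "uniformly_asymp ((\<Pi> l\<in>UNIV. conditioned_laws M T \<xi> r (A l)) \<times> ({..<d} \<rightarrow> admissible_times M A \<delta>))
          (\<lambda>(\<nu>, k) l. measure (\<nu> l) (visits T (A l) (\<lambda>j. C j l) (\<lambda>j. k j l) d))
          (\<lambda>(\<nu>, k) l. measure M (A l) ^ d * (\<Prod>j<d. measure M (C j l) / measure M (A l))
              * exp (- measure M (A l) * (\<Sum>j<d. real (k j l))))" (is ?W)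
    if C: "\<And>j l. j < d \<Longrightarrow> partition_measurable M \<xi> (C j l) \<and> 0 < measure M (C j l) \<and> C j l \<subseteq> A l"
      and \<delta>: "0 < \<delta>" "\<delta> \<le> 1" for d C \<delta>
  proof -
    define H where "H \<nu> k l = measure \<nu> (visits T (A l) (\<lambda>j. C j l) (\<lambda>j. k j l) d)"
      for \<nu> :: "'a measure" and k :: "nat \<Rightarrow> nat \<Rightarrow> nat" and l
    define G where "G k l = measure M (A l) ^ d * (\<Prod>j<d. measure M (C j l) / measure M (A l))
      * exp (- measure M (A l) * (\<Sum>j<d. real (k j l)))" for k :: "nat \<Rightarrow> nat \<Rightarrow> nat" and l
    \<comment> \<open>Being uniform also in the conditioning set \<open>B\<close>, this covers a
      fixed law with \<open>B = UNIV\<close> and a sequence of laws with \<open>B = A l\<close> by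
      the same index.\<close>
    have unif: "\<exists>l\<^sub>0. \<forall>l\<ge>l\<^sub>0. \<forall>B \<nu> k. \<nu> \<in> conditioned_laws M T \<xi> r B \<longrightarrow>
      k \<in> {..<d} \<rightarrow> admissible_times M A \<delta> \<longrightarrow> \<bar>H \<nu> k l / G k l - 1\<bar> \<le> \<epsilon>" if "0 < \<epsilon>" for \<epsilon>
    proof -
      from visits_uniform_asymptotics[where C = C and d = d, OF assms(2,6,4,5) \<delta> C that]
      obtain l\<^sub>0 where "\<forall>l\<ge>l\<^sub>0. \<forall>\<nu> k. regular \<nu> \<longrightarrow> measure \<nu> UNIV = 1 \<longrightarrow>
        k \<in> {..<d} \<rightarrow> admissible_times M A \<delta> \<longrightarrow> \<bar>H \<nu> k l / G k l - 1\<bar> \<le> \<epsilon>"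
        unfolding H_def G_def ..
      then show ?thesis
        using conditioned_laws_regular[OF \<open>0 < r\<close> r] by (intro exI[of _ l\<^sub>0]) simp
    qed
    have "uniformly_asymp (conditioned_laws M T \<xi> r UNIV \<times> ({..<d} \<rightarrow> admissible_times M A \<delta>))
        (\<lambda>(\<nu>, k) l. H \<nu> k l) (\<lambda>(\<nu>, k) l. G k l)"
      unfolding uniformly_asymp_def
    proof (intro allI impI)
      fix \<epsilon> :: real assume "0 < \<epsilon>"
      from unif[OF this] obtain l\<^sub>0 where l\<^sub>0: "\<forall>l\<ge>l\<^sub>0. \<forall>B \<nu> k. \<nu> \<in> conditioned_laws M T \<xi> r B \<longrightarrow>
        k \<in> {..<d} \<rightarrow> admissible_times M A \<delta> \<longrightarrow> \<bar>H \<nu> k l / G k l - 1\<bar> \<le> \<epsilon>" ..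
      show "\<exists>l\<^sub>0. \<forall>l\<ge>l\<^sub>0. \<forall>p\<in>conditioned_laws M T \<xi> r UNIV \<times> ({..<d} \<rightarrow> admissible_times M A \<delta>).
        \<bar>(case p of (\<nu>, k) \<Rightarrow> \<lambda>l. H \<nu> k l) l / (case p of (\<nu>, k) \<Rightarrow> \<lambda>l. G k l) l - 1\<bar> \<le> \<epsilon>"
      proof (intro exI[of _ l\<^sub>0] allI impI ballI, elim SigmaE)
        fix l p \<nu> k
        assume "l\<^sub>0 \<le> l" and p: "p = (\<nu>, k)" and "\<nu> \<in> conditioned_laws M T \<xi> r UNIV"
          and "k \<in> {..<d} \<rightarrow> admissible_times M A \<delta>"
        then show "\<bar>(case p of (\<nu>, k) \<Rightarrow> \<lambda>l. H \<nu> k l) l / (case p of (\<nu>, k) \<Rightarrow> \<lambda>l. G k l) l - 1\<bar> \<le> \<epsilon>"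
          unfolding p prod.case by (intro l\<^sub>0[rule_format])
      qed
    qed
    then show ?V by (simp only: H_def G_def)
    have "uniformly_asymp ((\<Pi> l\<in>UNIV. conditioned_laws M T \<xi> r (A l)) \<times> ({..<d} \<rightarrow> admissible_times M A \<delta>))
        (\<lambda>(\<nu>, k) l. H (\<nu> l) k l) (\<lambda>(\<nu>, k) l. G k l)"
      unfolding uniformly_asymp_def
    proof (intro allI impI)
      fix \<epsilon> :: real assume "0 < \<epsilon>"
      from unif[OF this] obtain l\<^sub>0 where l\<^sub>0: "\<forall>l\<ge>l\<^sub>0. \<forall>B \<nu> k. \<nu> \<in> conditioned_laws M T \<xi> r B \<longrightarrow>
        k \<in> {..<d} \<rightarrow> admissible_times M A \<delta> \<longrightarrow> \<bar>H \<nu> k l / G k l - 1\<bar> \<le> \<epsilon>" ..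
      show "\<exists>l\<^sub>0. \<forall>l\<ge>l\<^sub>0. \<forall>p\<in>(\<Pi> l\<in>UNIV. conditioned_laws M T \<xi> r (A l)) \<times> ({..<d} \<rightarrow> admissible_times M A \<delta>).
        \<bar>(case p of (\<nu>, k) \<Rightarrow> \<lambda>l. H (\<nu> l) k l) l / (case p of (\<nu>, k) \<Rightarrow> \<lambda>l. G k l) l - 1\<bar> \<le> \<epsilon>"
      proof (intro exI[of _ l\<^sub>0] allI impI ballI, elim SigmaE)
        fix l p \<nu> k
        assume "l\<^sub>0 \<le> l" and p: "p = (\<nu>, k)" and \<nu>: "\<nu> \<in> (\<Pi> l\<in>UNIV. conditioned_laws M T \<xi> r (A l))"
          and "k \<in> {..<d} \<rightarrow> admissible_times M A \<delta>"
        then show "\<bar>(case p of (\<nu>, k) \<Rightarrow> \<lambda>l. H (\<nu> l) k l) l / (case p of (\<nu>, k) \<Rightarrow> \<lambda>l. G k l) l - 1\<bar> \<le> \<epsilon>"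
          unfolding p prod.case by (intro l\<^sub>0[rule_format, OF _ Pi_mem[OF \<nu> UNIV_I]])
      qed
    qed
    then show ?W by (simp only: H_def G_def)
  qed
  have self: "partition_measurable M \<xi> (A l) \<and> 0 < measure M (A l) \<and> A l \<subseteq> A l" for l
    using assms by simp
  \<comment> \<open>For part A the sets \<open>C j l\<close> are taken to be \<open>A l\<close>, and
    the product of ratios becomes \<open>1\<close>.\<close>
  have ratio: "measure M (A l) / measure M (A l) = 1" for l using assms(4)[of l] by simp
  show ?thesis
  proof (intro conjI allI impI, goal_cases)
    case (1 d \<delta>)
    then show ?case using *[of d "\<lambda>_. A", OF self, of \<delta>] by (simp only: visits_eq_hitting ratio prod.neutral_const mult_1_right)
  next
    case (2 d \<delta>)
    then show ?case using **[of d "\<lambda>_. A", OF self, of \<delta>] by (simp only: visits_eq_hitting ratio prod.neutral_const mult_1_right)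
  next
    case (3 d C \<delta>)
    then show ?case using *[of d C \<delta>] by (simp only: visits_def)
  next
    case (4 d C \<delta>)
    then show ?case using **[of d C \<delta>] by (simp only: visits_def)
  qed
qed

end
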